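(* Let $(\mathbf{C}_m,\Phi)$ be a finitely concrete mono category having an empty-like element, and let $\mathcal{F}$ be a feature of $\mathbf{C}_m$. Suppose that $(\mathbf{C}_m,\Phi)$ satisfies the triangle condition. If $\sigma^{\mathcal F}$ (resp. $\rho^{\mathcal F}$) is tame-balanced, then $\sigma^{\mathcal F}$ (resp. $\rho^{\mathcal F}$) is tame-stable.
   Context: A mono category is a category in which every morphism is a monomorphism. $\mathbf{FinSet}_m$ is the category of finite sets and injective functions. A finitely concrete mono category $(\mathbf{C}_m,\Phi)$ is a mono category $\mathbf{C}_m$ equipped with a faithful functor $\Phi:\mathbf{C}_m\to\mathbf{FinSet}_m$. An empty-like element is an initial object $\hat\emptyset$ of $\mathbf{C}_m$ with $\Phi\hat\emptyset=\emptyset$. Triangle condition: for all morphisms $f:X\to Z$ and $g:Y\to Z$ of $\mathbf{C}_m$ and every injective function $\chi:\Phi X\to\Phi Y$ with $\Phi f=(\Phi g)\circ\chi$, there exists a morphism $\phi:X\to Y$ of $\mathbf{C}_m$ with $f=g\circ\phi$. For a morphism $\iota:X\to X'$ and $A\subseteq\Phi X$, write $\iota(A,X):=(\Phi\iota(A),X')$ (direct image). A feature of $\mathbf{C}_m$ is a set $\mathcal{F}$ of pairs $(A,X)$ with $X$ an object of $\mathbf{C}_m$ and $A\subseteq\Phi X$, such that for every isomorphism $f:X\to X'$ one has $(A,X)\in\mathcal{F}\iff(\Phi f(A),X')\in\mathcal{F}$. A filtration of $\mathbf{C}_m$ is a functor $F:(\mathbb{R},\le)\to\mathbf{C}_m$;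 write $F_u:=F(u)$, $F_u^v:=F(u\le v)$. A real $a$ is a critical value of $F$ if every open interval $I$ containing $a$ contains $u\le v$ such that $F_u^v$ is not an isomorphism; $F$ is tame if it has finitely many critical values. For $u\le v$, define $S^{\mathcal F}_F(u\le v)=\{(A,F_u) : A\subseteq\Phi F_u,\ \forall w\in[u,v],\ F_u^w(A,F_u)\in\mathcal F\}$, $R^{\mathcal F}_F(u\le v)=\{(A,F_u) : A\subseteq\Phi F_u,\ \exists x\le u,\ \exists y\ge v,\ \exists A'\subseteq\Phi F_x \text{ with } (A',F_x)\in\mathcal F,\ A=\Phi F_x^u(A'),\ F_u^y(A,F_u)\in\mathcal F\}$, and $\sigma^{\mathcal F}_F(u\le v)=|S^{\mathcal F}_F(u\le v)|$, $\rho^{\mathcal F}_F(u\le v)=|R^{\mathcal F}_F(u\le v)|$. The generators are $\sigma^{\mathcal F}:F\mapsto\sigma^{\mathcal F}_F$ and $\rho^{\mathcal F}:F\mapsto\rho^{\mathcal F}_F$; their values are persistence functions, i.e. functions $p$ from pairs $u\le v$ of reals to $\mathbb N$ such that for $u_1\le u_2\le v_1\le v_2$: $p(u_1\le v_1)\le p(u_2\le v_1)$, $p(u_2\le v_2)\le p(u_2\le v_1)$, and $p(u_2\le v_1)-p(u_1\le v_1)\ge p(u_2\le v_2)-p(u_1\le v_2)$. Persistence diagram. Given a persistence function $p$, set by convention $p(-\infty\le v):=\lim_{u\to-\infty}p(u\le v)$ and $p(u\le+\infty):=\lim_{v\to+\infty}p(u\le v)$ (these limits exist by the first two properties of persistence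 functions). For $u<v$ in $\mathbb R\cup\{-\infty,+\infty\}$, the multiplicity $\mu(u,v)$ is the minimum of $p(\sup I_u\le\inf I_v)-p(\inf I_u\le\inf I_v)-p(\sup I_u\le\sup I_v)+p(\inf I_u\le\sup I_v)$ over disjoint connected neighborhoods $I_u$ of $u$ and $I_v$ of $v$. By convention $\mu(u,u)=+\infty$. A point $(u,v)$ is a cornerpoint of $p$ if $\mu(u,v)>0$, and $Dgm(p)$ is the multiset of cornerpoints with multiplicity $\mu$. The bottleneck distance is $d_B(p,p')=\inf_\gamma\sup_{c\in Dgm(p)}\|c-\gamma(c)\|_\infty$, where $\gamma$ ranges over the bijections $Dgm(p)\to Dgm(p')$ of multisets. Interleaving. For $\epsilon\ge0$, filtrations $F,G$ are $\epsilon$-interleaved if there exist families of morphisms $(\phi_w:F_w\to G_{w+\epsilon})_{w\in\mathbb R}$ and $(\psi_w:G_w\to F_{w+\epsilon})_{w\in\mathbb R}$ such that for all $w$ and all $u\le v$: $\psi_w\phi_{w-\epsilon}=F_{w-\epsilon}^{w+\epsilon}$, $\phi_w\psi_{w-\epsilon}=G_{w-\epsilon}^{w+\epsilon}$, $F_{u+\epsilon}^{v+\epsilon}\psi_u=\psi_vG_u^v$, $G_{u+\epsilon}^{v+\epsilon}\phi_u=\phi_vF_u^v$. The interleaving distance $\delta(F,G)$ is the infimum of such $\epsilon$ ($+\infty$ if none exists). Persistence functions $p,p'$ are $\epsilon$-compatible if for all $u\le v$: $p(u-\epsilon\le v+\epsilon)\le p'(u\le v)$ and $p'(u-\epsilon\le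 v+\epsilon)\le p(u\le v)$. A generator $\pi\in\{\sigma^{\mathcal F},\rho^{\mathcal F}\}$ is tame-stable if $d_B(\pi(F),\pi(G))\le\delta(F,G)$ for all tame filtrations $F,G$ of $\mathbf{C}_m$; it is tame-balanced if for every $\epsilon\ge0$ and all $\epsilon$-interleaved tame filtrations $F,G$, $\pi(F)$ and $\pi(G)$ are $\epsilon$-compatible. *)

theory Defs
  imports "HOL-Analysis.Analysis"
begin

section \<open>Categories and functors\<close>

record ('o, 'm) cat =
  Obj :: "'o set"
  Arr :: "'m set"
  Dom :: "'m \<Rightarrow> 'o"
  Cod :: "'m \<Rightarrow> 'o"
  Ident :: "'o \<Rightarrow> 'm"
  Cmp :: "'m \<Rightarrow> 'm \<Rightarrow> 'm"  \<comment> \<open>\<open>Cmp C g f\<close> is \<open>g\<close> after \<open>f\<close>\<close>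

definition hom_set :: "('o, 'm) cat \<Rightarrow> 'o \<Rightarrow> 'o \<Rightarrow> 'm set" where
  "hom_set C X Y = {f \<in> Arr C. Dom C f = X \<and> Cod C f = Y}"

definition category :: "('o, 'm) cat \<Rightarrow> bool" where
  "category C \<longleftrightarrow>
     (\<forall>f\<in>Arr C. Dom C f \<in> Obj C \<and> Cod C f \<in> Obj C) \<and>
     (\<forall>X\<in>Obj C. Ident C X \<in> hom_set C X X) \<and>
     (\<forall>f\<in>Arr C. \<forall>g\<in>Arr C. Cod C f = Dom C g \<longrightarrow>
        Cmp C g f \<in> hom_set C (Dom C f) (Cod C g)) \<and>
     (\<forall>f\<in>Arr C. Cmp C f (Ident C (Dom C f)) = f \<and> Cmp C (Ident C (Cod C f)) f = f) \<and>
     (\<forall>f\<in>Arr C. \<forall>g\<in>Arr C. \<forall>h\<in>Arr C. Cod C f = Dom C g \<and> Cod C g = Dom C h \<longrightarrow>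
        Cmp C h (Cmp C g f) = Cmp C (Cmp C h g) f)"

definition monomorphism :: "('o, 'm) cat \<Rightarrow> 'm \<Rightarrow> bool" where
  "monomorphism C f \<longleftrightarrow> f \<in> Arr C \<and>
     (\<forall>W. \<forall>g \<in> hom_set C W (Dom C f). \<forall>h \<in> hom_set C W (Dom C f).
        Cmp C f g = Cmp C f h \<longrightarrow> g = h)"

definition isomorphism :: "('o, 'm) cat \<Rightarrow> 'm \<Rightarrow> bool" where
  "isomorphism C f \<longleftrightarrow> f \<in> Arr C \<and>
     (\<exists>g \<in> hom_set C (Cod C f) (Dom C f).
        Cmp C g f = Ident C (Dom C f) \<and> Cmp C f g = Ident C (Cod C f))"

definition mono_category :: "('o, 'm) cat \<Rightarrow> bool" where
  "mono_category C \<longleftrightarrow> category C \<and> (\<forall>f\<in>Arr C. monomorphism C f)"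

definition initial_object :: "('o, 'm) cat \<Rightarrow> 'o \<Rightarrow> bool" where
  "initial_object C E \<longleftrightarrow> E \<in> Obj C \<and> (\<forall>X\<in>Obj C. \<exists>!f. f \<in> hom_set C E X)"

record ('o, 'm, 'p, 'n) cfunctor =
  onObj :: "'o \<Rightarrow> 'p"
  onArr :: "'m \<Rightarrow> 'n"

definition is_functor ::
  "('o, 'm) cat \<Rightarrow> ('p, 'n) cat \<Rightarrow> ('o, 'm, 'p, 'n) cfunctor \<Rightarrow> bool" where
  "is_functor C D F \<longleftrightarrow>
     (\<forall>X\<in>Obj C. onObj F X \<in> Obj D) \<and>
     (\<forall>f\<in>Arr C. onArr F f \<in> hom_set D (onObj F (Dom C f)) (onObj F (Cod C f))) \<and>
     (\<forall>X\<in>Obj C. onArr F (Ident C X) = Ident D (onObj F X)) \<and>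
     (\<forall>f\<in>Arr C. \<forall>g\<in>Arr C. Cod C f = Dom C g \<longrightarrow>
        onArr F (Cmp C g f) = Cmp D (onArr F g) (onArr F f))"

definition faithful :: "('o, 'm) cat \<Rightarrow> ('o, 'm, 'p, 'n) cfunctor \<Rightarrow> bool" where
  "faithful C F \<longleftrightarrow>
     (\<forall>X\<in>Obj C. \<forall>Y\<in>Obj C. inj_on (onArr F) (hom_set C X Y))"

section \<open>Finitely concrete mono categories\<close>

text \<open>An arrow of \<open>FinSet\<^sub>m\<close> is a triple \<open>(A, f, B)\<close>. The function \<open>f\<close> is extensional, i.e.
  \<^const>\<open>undefined\<close> outside \<open>A\<close>, so that equality of arrows is equality of functions on \<open>A\<close>.\<close>

definition FinSet_m :: "('a set, 'a set \<times> ('a \<Rightarrow> 'a) \<times> 'a set) cat" where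
  "FinSet_m = \<lparr>
     Obj = {A. finite A},
     Arr = {(A, f, B). finite A \<and> finite B \<and> f \<in> A \<rightarrow>\<^sub>E B \<and> inj_on f A},
     Dom = (\<lambda>(A, f, B). A),
     Cod = (\<lambda>(A, f, B). B),
     Ident = (\<lambda>A. (A, \<lambda>x\<in>A. x, A)),
     Cmp = (\<lambda>(B', g, D) (A, f, B). (A, compose A g f, D))\<rparr>"

type_synonym ('o, 'm, 'a) concretion =
  "('o, 'm, 'a set, 'a set \<times> ('a \<Rightarrow> 'a) \<times> 'a set) cfunctor"

definition finitely_concrete_mono_category ::
  "('o, 'm) cat \<Rightarrow> ('o, 'm, 'a) concretion \<Rightarrow> bool" where
  "finitely_concrete_mono_category C \<Phi> \<longleftrightarrow>
     mono_category C \<and> is_functor C FinSet_m \<Phi> \<and> faithful C \<Phi>"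

definition empty_like :: "('o, 'm) cat \<Rightarrow> ('o, 'm, 'a) concretion \<Rightarrow> 'o \<Rightarrow> bool" where
  "empty_like C \<Phi> E \<longleftrightarrow> initial_object C E \<and> onObj \<Phi> E = {}"

definition triangle_condition :: "('o, 'm) cat \<Rightarrow> ('o, 'm, 'a) concretion \<Rightarrow> bool" where
  "triangle_condition C \<Phi> \<longleftrightarrow>
     (\<forall>X\<in>Obj C. \<forall>Y\<in>Obj C. \<forall>Z\<in>Obj C. \<forall>f \<in> hom_set C X Z. \<forall>g \<in> hom_set C Y Z.
        \<forall>h \<in> hom_set FinSet_m (onObj \<Phi> X) (onObj \<Phi> Y).
          onArr \<Phi> f = Cmp FinSet_m (onArr \<Phi> g) h \<longrightarrow>
          (\<exists>\<phi> \<in> hom_set C X Y. f = Cmp C g \<phi>))"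

text \<open>The pair \<open>\<iota>(A, X) = (\<Phi> \<iota> (A), X')\<close> for \<open>\<iota> : X \<rightarrow> X'\<close>.\<close>

definition push ::
  "('o, 'm) cat \<Rightarrow> ('o, 'm, 'a) concretion \<Rightarrow> 'm \<Rightarrow> 'a set \<times> 'o \<Rightarrow> 'a set \<times> 'o" where
  "push C \<Phi> \<iota> P = (fst (snd (onArr \<Phi> \<iota>)) ` fst P, Cod C \<iota>)"

definition feature ::
  "('o, 'm) cat \<Rightarrow> ('o, 'm, 'a) concretion \<Rightarrow> ('a set \<times> 'o) set \<Rightarrow> bool" where
  "feature C \<Phi> \<F> \<longleftrightarrow>
     (\<forall>(A, X) \<in> \<F>. X \<in> Obj C \<and> A \<subseteq> onObj \<Phi> X) \<and>
     (\<forall>X\<in>Obj C. \<forall>X'\<in>Obj C. \<forall>f \<in> hom_set C X X'. isomorphism C f \<longrightarrow>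
        (\<forall>A \<subseteq> onObj \<Phi> X. (A, X) \<in> \<F> \<longleftrightarrow> push C \<Phi> f (A, X) \<in> \<F>))"

section \<open>Filtrations\<close>

definition real_cat :: "(real, real \<times> real) cat" where
  "real_cat = \<lparr>Obj = UNIV, Arr = {(u, v). u \<le> v}, Dom = fst, Cod = snd,
     Ident = (\<lambda>u. (u, u)), Cmp = (\<lambda>(v', w) (u, v). (u, w))\<rparr>"

type_synonym ('o, 'm) filtr = "(real, real \<times> real, 'o, 'm) cfunctor"

abbreviation at_level :: "('o, 'm) filtr \<Rightarrow> real \<Rightarrow> 'o" where
  "at_level F u \<equiv> onObj F u"

abbreviation transition :: "('o, 'm) filtr \<Rightarrow> real \<Rightarrow> real \<Rightarrow> 'm" where
  "transition F u v \<equiv> onArr F (u, v)"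

definition filtration :: "('o, 'm) cat \<Rightarrow> ('o, 'm) filtr \<Rightarrow> bool" where
  "filtration C F \<longleftrightarrow> is_functor real_cat C F"

definition critical_value :: "('o, 'm) cat \<Rightarrow> ('o, 'm) filtr \<Rightarrow> real \<Rightarrow> bool" where
  "critical_value C F a \<longleftrightarrow>
     (\<forall>I. open I \<and> is_interval I \<and> a \<in> I \<longrightarrow>
        (\<exists>u\<in>I. \<exists>v\<in>I. u \<le> v \<and> \<not> isomorphism C (transition F u v)))"

definition tame_filtration :: "('o, 'm) cat \<Rightarrow> ('o, 'm) filtr \<Rightarrow> bool" where
  "tame_filtration C F \<longleftrightarrow> filtration C F \<and> finite {a. critical_value C F a}"

section \<open>Steady and ranging generators\<close>

definition steady_set ::
  "('o, 'm) cat \<Rightarrow> ('o, 'm, 'a) concretion \<Rightarrow> ('a set \<times> 'o) set \<Rightarrow> ('o, 'm) filtr \<Rightarrow>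
   real \<Rightarrow> real \<Rightarrow> ('a set \<times> 'o) set" where
  "steady_set C \<Phi> \<F> F u v =
     {(A, X). X = at_level F u \<and> A \<subseteq> onObj \<Phi> (at_level F u) \<and>
        (\<forall>w\<in>{u..v}. push C \<Phi> (transition F u w) (A, at_level F u) \<in> \<F>)}"

definition ranging_set ::
  "('o, 'm) cat \<Rightarrow> ('o, 'm, 'a) concretion \<Rightarrow> ('a set \<times> 'o) set \<Rightarrow> ('o, 'm) filtr \<Rightarrow>
   real \<Rightarrow> real \<Rightarrow> ('a set \<times> 'o) set" where
  "ranging_set C \<Phi> \<F> F u v =
     {(A, X). X = at_level F u \<and> A \<subseteq> onObj \<Phi> (at_level F u) \<and>
        (\<exists>x\<le>u. \<exists>y\<ge>v. \<exists>A' \<subseteq> onObj \<Phi> (at_level F x).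
           (A', at_level F x) \<in> \<F> \<and>
           (A, at_level F u) = push C \<Phi> (transition F x u) (A', at_level F x) \<and>
           push C \<Phi> (transition F u y) (A, at_level F u) \<in> \<F>)}"

text \<open>A persistence function is represented by a curried function of type
  \<^typ>\<open>real \<Rightarrow> real \<Rightarrow> nat\<close>, of which only the values at \<open>u \<le> v\<close> are relevant.\<close>

definition steady_generator ::
  "('o, 'm) cat \<Rightarrow> ('o, 'm, 'a) concretion \<Rightarrow> ('a set \<times> 'o) set \<Rightarrow>
   ('o, 'm) filtr \<Rightarrow> real \<Rightarrow> real \<Rightarrow> nat" where
  "steady_generator C \<Phi> \<F> F u v = card (steady_set C \<Phi> \<F> F u v)"

definition ranging_generator ::
  "('o, 'm) cat \<Rightarrow> ('o, 'm, 'a) concretion \<Rightarrow> ('a set \<times> 'o) set \<Rightarrow>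
   ('o, 'm) filtr \<Rightarrow> real \<Rightarrow> real \<Rightarrow> nat" where
  "ranging_generator C \<Phi> \<F> F u v = card (ranging_set C \<Phi> \<F> F u v)"

section \<open>Persistence diagrams and bottleneck distance\<close>

text \<open>Extension of \<open>p\<close> to \<open>-\<infinity> \<le> u < \<infinity>\<close> and \<open>-\<infinity> < v \<le> \<infinity>\<close> by limits. At
  \<open>(-\<infinity>, \<infinity>)\<close> the two limits commute by monotonicity of \<open>p\<close>.\<close>

definition pers_ext :: "(real \<Rightarrow> real \<Rightarrow> nat) \<Rightarrow> ereal \<Rightarrow> ereal \<Rightarrow> nat" where
  "pers_ext p u v =
     (let q = (\<lambda>s. if v = \<infinity> then Lim at_top (\<lambda>t. p s t) else p s (real_of_ereal v))
      in if u = -\<infinity> then Lim at_bot q else q (real_of_ereal u))"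

text \<open>Neighbourhoods are taken in the extended real line. For \<open>u < v\<close> the suprema and infima
  below stay in the range where \<^const>\<open>pers_ext\<close> is meaningful.\<close>

definition box_values :: "(real \<Rightarrow> real \<Rightarrow> nat) \<Rightarrow> ereal \<Rightarrow> ereal \<Rightarrow> int set" where
  "box_values p u v =
     {int (pers_ext p (Sup I) (Inf J)) - int (pers_ext p (Inf I) (Inf J))
        - int (pers_ext p (Sup I) (Sup J)) + int (pers_ext p (Inf I) (Sup J)) | I J.
      connected I \<and> connected J \<and> I \<inter> J = {} \<and> u \<in> interior I \<and> v \<in> interior J}"

definition multiplicity_at :: "(real \<Rightarrow> real \<Rightarrow> nat) \<Rightarrow> ereal \<times> ereal \<Rightarrow> enat" where
  "multiplicity_at p = (\<lambda>(u, v).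
     if u = v then \<infinity>
     else if u < v then enat (nat (LEAST m. m \<in> box_values p u v))
     else 0)"

text \<open>The multiset of cornerpoints as a set: a cornerpoint \<open>c\<close> of multiplicity \<open>m\<close> contributes
  the \<open>m\<close> labelled copies \<open>(c, i)\<close> with \<open>i < m\<close>, countably many if \<open>m = \<infinity>\<close>.\<close>

definition Dgm :: "(real \<Rightarrow> real \<Rightarrow> nat) \<Rightarrow> ((ereal \<times> ereal) \<times> nat) set" where
  "Dgm p = {(c, i). enat i < multiplicity_at p c}"

text \<open>The case distinction sets \<open>\<bar>\<infinity> - \<infinity>\<bar> = 0\<close>.\<close>

definition ext_dist :: "ereal \<Rightarrow> ereal \<Rightarrow> ereal" where
  "ext_dist x y = (if x = y then 0 else \<bar>x - y\<bar>)"

definition linf_dist :: "ereal \<times> ereal \<Rightarrow> ereal \<times> ereal \<Rightarrow> ereal" where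
  "linf_dist c c' = max (ext_dist (fst c) (fst c')) (ext_dist (snd c) (snd c'))"

definition bottleneck :: "(real \<Rightarrow> real \<Rightarrow> nat) \<Rightarrow> (real \<Rightarrow> real \<Rightarrow> nat) \<Rightarrow> ereal" where
  "bottleneck p p' =
     (INF \<gamma> \<in> {\<gamma>. bij_betw \<gamma> (Dgm p) (Dgm p')}.
        SUP c \<in> Dgm p. linf_dist (fst c) (fst (\<gamma> c)))"

section \<open>Interleavings, stable and balanced generators\<close>

definition interleaved ::
  "('o, 'm) cat \<Rightarrow> real \<Rightarrow> ('o, 'm) filtr \<Rightarrow> ('o, 'm) filtr \<Rightarrow> bool" where
  "interleaved C \<epsilon> F G \<longleftrightarrow>
     (\<exists>\<phi> \<psi>.
        (\<forall>w. \<phi> w \<in> hom_set C (at_level F w) (at_level G (w + \<epsilon>))) \<and>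
        (\<forall>w. \<psi> w \<in> hom_set C (at_level G w) (at_level F (w + \<epsilon>))) \<and>
        (\<forall>w. Cmp C (\<psi> w) (\<phi> (w - \<epsilon>)) = transition F (w - \<epsilon>) (w + \<epsilon>)) \<and>
        (\<forall>w. Cmp C (\<phi> w) (\<psi> (w - \<epsilon>)) = transition G (w - \<epsilon>) (w + \<epsilon>)) \<and>
        (\<forall>u v. u \<le> v \<longrightarrow>
           Cmp C (transition F (u + \<epsilon>) (v + \<epsilon>)) (\<psi> u) = Cmp C (\<psi> v) (transition G u v)) \<and>
        (\<forall>u v. u \<le> v \<longrightarrow>
           Cmp C (transition G (u + \<epsilon>) (v + \<epsilon>)) (\<phi> u) = Cmp C (\<phi> v) (transition F u v)))"

definition interleaving_distance ::
  "('o, 'm) cat \<Rightarrow> ('o, 'm) filtr \<Rightarrow> ('o, 'm) filtr \<Rightarrow> ereal" where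
  "interleaving_distance C F G = Inf {ereal \<epsilon> | \<epsilon>. 0 \<le> \<epsilon> \<and> interleaved C \<epsilon> F G}"

definition compatible ::
  "real \<Rightarrow> (real \<Rightarrow> real \<Rightarrow> nat) \<Rightarrow> (real \<Rightarrow> real \<Rightarrow> nat) \<Rightarrow> bool" where
  "compatible \<epsilon> p p' \<longleftrightarrow>
     (\<forall>u v. u \<le> v \<longrightarrow> p (u - \<epsilon>) (v + \<epsilon>) \<le> p' u v \<and> p' (u - \<epsilon>) (v + \<epsilon>) \<le> p u v)"

definition tame_stable ::
  "('o, 'm) cat \<Rightarrow> (('o, 'm) filtr \<Rightarrow> real \<Rightarrow> real \<Rightarrow> nat) \<Rightarrow> bool" where
  "tame_stable C \<pi> \<longleftrightarrow>
     (\<forall>F G. tame_filtration C F \<and> tame_filtration C G \<longrightarrow>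
        bottleneck (\<pi> F) (\<pi> G) \<le> interleaving_distance C F G)"

definition tame_balanced ::
  "('o, 'm) cat \<Rightarrow> (('o, 'm) filtr \<Rightarrow> real \<Rightarrow> real \<Rightarrow> nat) \<Rightarrow> bool" where
  "tame_balanced C \<pi> \<longleftrightarrow>
     (\<forall>\<epsilon>\<ge>0. \<forall>F G. tame_filtration C F \<and> tame_filtration C G \<and> interleaved C \<epsilon> F G \<longrightarrow>
        compatible \<epsilon> (\<pi> F) (\<pi> G))"

end

theory Submission
  imports Defs
begin

text \<open>
  The diagrams of two interleaved filtrations are compared bar by bar: both are indexed by the
  subsets of one finite set, and corresponding bars are close unless both are short.

  A tame filtration \<open>F\<close> becomes constant, so its underlying sets embed compatibly into one finite
  set \<open>U\<close> (\<open>tame_has_cocone\<close>). For \<open>A \<subseteq> U\<close> let \<open>T\<^sub>A\<close> be the set of levels \<open>w\<close> at which \<open>A\<close> is the image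
  of a feature of \<open>F\<^sub>w\<close>. The ranging function at \<open>(u, v)\<close> counts the \<open>A\<close> whose set \<open>T\<^sub>A\<close> has a point up
  to \<open>u\<close> and a point from \<open>v\<close> on. For a function of this shape the cornerpoints off the diagonal are
  the finite pairs \<open>(Inf T\<^sub>A, Sup T\<^sub>A)\<close> (\<open>multiplicity_at_barcode\<close>). An \<open>\<epsilon>\<close>-interleaving of \<open>F\<close> with \<open>G\<close>
  carries the embeddings into \<open>U\<close> over to \<open>G\<close> (\<open>interleaved_cocones\<close>) and so gives sets \<open>T'\<^sub>A\<close>, also
  indexed by \<open>A \<subseteq> U\<close>. Suppose that for all \<open>x, y \<in> T\<^sub>A\<close> with \<open>x + 2\<epsilon> \<le> y\<close> the set \<open>T'\<^sub>A\<close> has a point up to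
  \<open>x + \<epsilon>\<close> and a point from \<open>y - \<epsilon>\<close> on, and the same with \<open>T\<^sub>A\<close> and \<open>T'\<^sub>A\<close> exchanged. Then a bar longer
  than \<open>2\<epsilon>\<close> is matched with its counterpart, any other bar can be sent to the diagonal, and the
  bottleneck distance is at most \<open>\<epsilon>\<close> (\<open>bottleneck_le_of_eroded_bars\<close>).

  This erosion property is what balancedness provides. Take two step filtrations through the same
  objects of a chain, with slightly different jump times. They are interleaved, and both values of
  the generator count subsets of one finite set. The jump times can be chosen so that the inequality
  given by balancedness is opposite to an inclusion of the counted families, which are then equal.
  For the steady generator this shows that a feature at both ends of a chain \<open>X \<rightarrow> Y \<rightarrow> Z\<close> is a
  feature at \<open>Y\<close> (\<open>steady_balanced_imp_convex\<close>); every \<open>T\<^sub>A\<close> is then an interval, and the steady and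
  ranging functions agree. For the ranging generator, a feature at \<open>X\<close> and \<open>Z\<close> in a chain
  \<open>L \<rightarrow> X \<rightarrow> Y \<rightarrow> Z\<close> is a feature at \<open>L\<close> or \<open>Y\<close>, and in a chain \<open>X \<rightarrow> Y \<rightarrow> Z \<rightarrow> R\<close> it is one at \<open>Y\<close> or \<open>R\<close>
  (\<open>ranging_balanced_imp_bridging\<close>). Apply the former to \<open>F\<^sub>l \<rightarrow> F\<^sub>x \<rightarrow> G\<^bsub>x+\<epsilon>\<^esub> \<rightarrow> F\<^sub>y\<close>, where \<open>l\<close> is so small that
  \<open>F\<close> is constant up to \<open>l\<close>: then \<open>G\<^bsub>l-\<epsilon>\<^esub> \<rightarrow> F\<^sub>l\<close> is an isomorphism, and in both cases the feature occurs
  in \<open>G\<close> no later than \<open>x + \<epsilon>\<close>. The other chain bounds its disappearance (\<open>present_eroded\<close>).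
\<close>

section \<open>Barcodes and the multiplicities of their cornerpoints\<close>

text \<open>For real \<open>u\<close> the second disjunct implies the first, so it takes effect only at \<open>-\<infinity>\<close>, where it
  gives the limit of the values at real \<open>u\<close>. The same holds for \<open>lasts_to\<close> at \<open>\<infinity>\<close>.\<close>

definition starts_by :: "real set \<Rightarrow> ereal \<Rightarrow> bool" where
  "starts_by T u \<longleftrightarrow> (\<exists>x\<in>T. ereal x \<le> u) \<or> Inf (ereal ` T) = -\<infinity>"

definition lasts_to :: "real set \<Rightarrow> ereal \<Rightarrow> bool" where
  "lasts_to T v \<longleftrightarrow> (\<exists>y\<in>T. v \<le> ereal y) \<or> Sup (ereal ` T) = \<infinity>"

lemma starts_by_real [simp]: "starts_by T (ereal u) \<longleftrightarrow> (\<exists>x\<in>T. x \<le> u)"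
proof -
  have "\<exists>x\<in>T. x \<le> u" if "Inf (ereal ` T) = -\<infinity>"
  proof -
    have "Inf (ereal ` T) < ereal u" using that by simp
    then show ?thesis by (auto simp: Inf_less_iff intro: less_imp_le)
  qed
  then show ?thesis by (auto simp: starts_by_def)
qed

lemma lasts_to_real [simp]: "lasts_to T (ereal v) \<longleftrightarrow> (\<exists>y\<in>T. v \<le> y)"
proof -
  have "\<exists>x\<in>T. v \<le> x" if "Sup (ereal ` T) = \<infinity>"
  proof -
    have "ereal v < Sup (ereal ` T)" using that by simp
    then show ?thesis by (auto simp: less_Sup_iff intro: less_imp_le)
  qed
  then show ?thesis by (auto simp: lasts_to_def)
qed

lemma starts_by_MInf [simp]: "starts_by T (-\<infinity>) \<longleftrightarrow> Inf (ereal ` T) = -\<infinity>"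
  by (auto simp: starts_by_def)

lemma lasts_to_PInf [simp]: "lasts_to T \<infinity> \<longleftrightarrow> Sup (ereal ` T) = \<infinity>"
  by (auto simp: lasts_to_def)

lemma starts_by_mono: "starts_by T u \<Longrightarrow> u \<le> u' \<Longrightarrow> starts_by T u'"
  unfolding starts_by_def using order_trans by blast

lemma lasts_to_antimono: "lasts_to T v \<Longrightarrow> v' \<le> v \<Longrightarrow> lasts_to T v'"
  unfolding lasts_to_def using order_trans by blast

lemma Inf_less_imp_starts_by: "Inf (ereal ` T) < u \<Longrightarrow> starts_by T u"
  unfolding starts_by_def by (auto simp: Inf_less_iff intro: less_imp_le)

lemma starts_by_imp_Inf_le: "starts_by T u \<Longrightarrow> Inf (ereal ` T) \<le> u"
  unfolding starts_by_def by (auto intro: Inf_lower2)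

lemma less_Sup_imp_lasts_to: "v < Sup (ereal ` T) \<Longrightarrow> lasts_to T v"
  unfolding lasts_to_def by (auto simp: less_Sup_iff intro: less_imp_le)

lemma lasts_to_imp_le_Sup: "lasts_to T v \<Longrightarrow> v \<le> Sup (ereal ` T)"
  unfolding lasts_to_def by (auto intro: Sup_upper2)

lemma eventually_starts_by_at_bot:
  "\<forall>\<^sub>F u in at_bot. starts_by T (ereal u) = starts_by T (-\<infinity>)"
proof (cases "Inf (ereal ` T) = -\<infinity>")
  case True
  then show ?thesis by (simp add: starts_by_def)
next
  case False
  then have "- \<infinity> < Inf (ereal ` T)" by simp
  then obtain c where c: "ereal c < Inf (ereal ` T)"
    using ereal_dense2 by blast
  then have "\<not> starts_by T (ereal c)" using starts_by_imp_Inf_le leD by blast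
  then have "\<not> starts_by T (ereal u)" if "u \<le> c" for u
    using starts_by_mono that ereal_less_eq(3) by blast
  then show ?thesis
    using False unfolding eventually_at_bot_linorder starts_by_MInf by blast
qed

lemma eventually_lasts_to_at_top:
  "\<forall>\<^sub>F v in at_top. lasts_to T (ereal v) = lasts_to T \<infinity>"
proof (cases "Sup (ereal ` T) = \<infinity>")
  case True
  then show ?thesis by (simp add: lasts_to_def)
next
  case False
  then have "Sup (ereal ` T) < \<infinity>" by simp
  then obtain c where c: "Sup (ereal ` T) < ereal c"
    using ereal_dense2 by blast
  then have "\<not> lasts_to T (ereal c)" using lasts_to_imp_le_Sup leD by blast
  then have "\<not> lasts_to T (ereal u)" if "c \<le> u" for u
    using lasts_to_antimono that ereal_less_eq(3) by blast
  then show ?thesis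
    using False unfolding eventually_at_top_linorder lasts_to_PInf by blast
qed

text \<open>Bars are sets rather than intervals, because the levels at which a subset is a feature can have
  gaps between them. Only the two ends of a bar matter for \<open>p\<close>.\<close>

definition barcode :: "'k set \<Rightarrow> ('k \<Rightarrow> real set) \<Rightarrow> (real \<Rightarrow> real \<Rightarrow> nat) \<Rightarrow> bool" where
  "barcode K T p \<longleftrightarrow> finite K \<and>
     (\<forall>u v. u \<le> v \<longrightarrow> p u v = card {k \<in> K. (\<exists>x\<in>T k. x \<le> u) \<and> (\<exists>y\<in>T k. v \<le> y)})"

definition bar_count :: "'k set \<Rightarrow> ('k \<Rightarrow> real set) \<Rightarrow> ereal \<Rightarrow> ereal \<Rightarrow> nat" where
  "bar_count K T u v = card {k \<in> K. starts_by (T k) u \<and> lasts_to (T k) v}"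

lemma barcode_imp_bar_count:
  "barcode K T p \<Longrightarrow> u \<le> v \<Longrightarrow> p u v = bar_count K T (ereal u) (ereal v)"
  unfolding barcode_def bar_count_def by simp

lemma Lim_at_top_bar_count:
  assumes "barcode K T p"
  shows "Lim at_top (\<lambda>t. p s t) = bar_count K T (ereal s) \<infinity>"
proof -
  have "\<forall>\<^sub>F t in at_top. \<forall>k\<in>K. lasts_to (T k) (ereal t) = lasts_to (T k) \<infinity>"
    using assms eventually_lasts_to_at_top
    by (intro eventually_ball_finite) (auto simp: barcode_def)
  moreover have "\<forall>\<^sub>F t in at_top. s \<le> t" by (rule eventually_ge_at_top)
  ultimately have "\<forall>\<^sub>F t in at_top. p s t = bar_count K T (ereal s) \<infinity>"
  proof eventually_elim
    case (elim t)
    then show ?case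
      using barcode_imp_bar_count[OF assms, of s t] unfolding bar_count_def
      by (auto intro!: arg_cong[where f = card])
  qed
  then show ?thesis by (intro tendsto_Lim tendsto_eventually) auto
qed

lemma Lim_at_bot_bar_count:
  assumes "finite K" and "\<forall>\<^sub>F s in at_bot. q s = bar_count K T (ereal s) v"
  shows "Lim at_bot q = bar_count K T (-\<infinity>) v"
proof -
  have "\<forall>\<^sub>F s in at_bot. \<forall>k\<in>K. starts_by (T k) (ereal s) = starts_by (T k) (-\<infinity>)"
    using assms(1) eventually_starts_by_at_bot by (intro eventually_ball_finite) auto
  with assms(2) have "\<forall>\<^sub>F s in at_bot. q s = bar_count K T (-\<infinity>) v"
  proof eventually_elim
    case (elim s)
    then show ?case unfolding bar_count_def by (auto intro!: arg_cong[where f = card])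
  qed
  then show ?thesis by (intro tendsto_Lim tendsto_eventually) auto
qed

text \<open>The limits defining \<^const>\<open>pers_ext\<close> are attained, because each of the finitely many bars
  eventually stops changing its status.\<close>

lemma pers_ext_eq_bar_count:
  assumes p: "barcode K T p" and "u \<le> v" "u < \<infinity>" "-\<infinity> < v"
  shows "pers_ext p u v = bar_count K T u v"
proof -
  define q where
    "q = (\<lambda>s. if v = \<infinity> then Lim at_top (\<lambda>t. p s t) else p s (real_of_ereal v))"
  have q: "q s = bar_count K T (ereal s) v" if "ereal s \<le> v" for s
  proof (cases v)
    case (real r)
    then show ?thesis using that barcode_imp_bar_count[OF p, of s r] by (simp add: q_def)
  next
    case PInf
    then show ?thesis using Lim_at_top_bar_count[OF p] by (simp add: q_def)
  qed (use assms in auto)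
  have ext: "pers_ext p u v = (if u = -\<infinity> then Lim at_bot q else q (real_of_ereal u))"
    unfolding pers_ext_def q_def by (simp add: Let_def)
  show ?thesis
  proof (cases u)
    case MInf
    obtain r where r: "ereal r < v" using \<open>-\<infinity> < v\<close> ereal_dense2 by blast
    have "\<forall>\<^sub>F s in at_bot. q s = bar_count K T (ereal s) v"
      using eventually_le_at_bot[of r]
    proof eventually_elim
      case (elim s)
      then have "ereal s \<le> v" using r by (meson ereal_less_eq(3) less_imp_le order_trans)
      then show ?case by (rule q)
    qed
    then show ?thesis
      using ext MInf Lim_at_bot_bar_count[of K q T v] p by (simp add: barcode_def)
  qed (use ext q assms in auto)
qed

text \<open>Starting in time and lasting long enough are independent conditions on a bar, so its
  contribution to a box is a product of two differences. This makes all contributions nonnegative.\<close>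

lemma box_eq_sum:
  fixes K :: "'k set"
  assumes "finite K"
  shows "int (bar_count K T s t) - int (bar_count K T i t) - int (bar_count K T s r)
           + int (bar_count K T i r)
         = (\<Sum>k\<in>K. (of_bool (starts_by (T k) s) - of_bool (starts_by (T k) i))
              * (of_bool (lasts_to (T k) t) - of_bool (lasts_to (T k) r)))"
proof -
  have *: "int (bar_count K T a b)
      = (\<Sum>k\<in>K. of_bool (starts_by (T k) a) * of_bool (lasts_to (T k) b))" for a b
  proof -
    have "(\<Sum>k\<in>K. of_bool (starts_by (T k) a) * of_bool (lasts_to (T k) b))
        = (\<Sum>k\<in>K. if starts_by (T k) a \<and> lasts_to (T k) b then 1 else (0::int))"
      by (intro sum.cong) auto
    also have "\<dots> = int (bar_count K T a b)"
      using assms by (simp add: bar_count_def flip: sum.inter_filter)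
    finally show ?thesis by simp
  qed
  show ?thesis
    unfolding * by (simp add: algebra_simps sum.distrib sum_subtractf)
qed

text \<open>The coordinates have to be finite: a neighbourhood of \<open>-\<infinity>\<close> has infimum \<open>-\<infinity>\<close>, where the extended
  function takes its limit, so a bar that is unbounded below is counted with both signs and
  contributes nothing. The same happens at \<open>\<infinity>\<close>.\<close>

definition bars_at :: "'k set \<Rightarrow> ('k \<Rightarrow> real set) \<Rightarrow> ereal \<Rightarrow> ereal \<Rightarrow> 'k set" where
  "bars_at K T u v =
     {k \<in> K. Inf (ereal ` T k) = u \<and> Sup (ereal ` T k) = v \<and> \<bar>u\<bar> \<noteq> \<infinity> \<and> \<bar>v\<bar> \<noteq> \<infinity>}"

lemma disjoint_neighbourhoods_ordered:
  fixes u v :: ereal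
  assumes "connected I" "connected J" "I \<inter> J = {}" "u \<in> I" "v \<in> J" "u < v"
  shows "Sup I \<le> Inf J"
proof (intro Sup_least Inf_greatest)
  fix x y assume x: "x \<in> I" and y: "y \<in> J"
  show "x \<le> y"
  proof (rule ccontr)
    assume "\<not> x \<le> y"
    then have "y \<in> I \<or> u \<in> J"
      using connectedD_interval[OF assms(1) \<open>u \<in> I\<close> x, of y]
        connectedD_interval[OF assms(2) y \<open>v \<in> J\<close>, of u] \<open>u < v\<close>
      by (meson le_cases less_imp_le not_le)
    then show False using assms y by blast
  qed
qed

lemma interior_imp_less_Sup:
  fixes u :: ereal
  assumes "u \<in> interior I" "u < w"
  shows "u < Sup I"
proof -
  obtain b where b: "u < b" "{u..<b} \<subseteq> interior I"
    using open_right[OF open_interior assms] by auto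
  obtain c where "u < c" "c < b" using dense[OF b(1)] by auto
  moreover from this have "c \<in> I" using b interior_subset by fastforce
  ultimately show ?thesis by (meson Sup_upper less_le_trans)
qed

lemma interior_imp_Inf_less:
  fixes u :: ereal
  assumes "u \<in> interior I" "w < u"
  shows "Inf I < u"
proof -
  obtain b where b: "b < u" "{b<..u} \<subseteq> interior I"
    using open_left[OF open_interior assms] by auto
  obtain c where "b < c" "c < u" using dense[OF b(1)] by auto
  moreover from this have "c \<in> I" using b interior_subset by fastforce
  ultimately show ?thesis by (meson Inf_lower le_less_trans)
qed

lemma gap_above:
  fixes u w :: ereal
  assumes "finite A" "u < w"
  obtains s where "u < s" "s < w" "\<And>a. a \<in> A \<Longrightarrow> u < a \<Longrightarrow> s < a"
proof -
  define m where "m = Min (insert w {a \<in> A. u < a})"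
  have "u < m" using assms unfolding m_def by (subst Min_gr_iff) auto
  then obtain s where "u < s" "s < m" using dense by blast
  moreover have "m \<le> w" "\<And>a. a \<in> A \<Longrightarrow> u < a \<Longrightarrow> m \<le> a"
    using assms unfolding m_def by (auto intro!: Min_le)
  ultimately show thesis using that by (meson less_le_trans)
qed

lemma gap_below:
  fixes u w :: ereal
  assumes "finite A" "w < u"
  obtains s where "w < s" "s < u" "\<And>a. a \<in> A \<Longrightarrow> a < u \<Longrightarrow> a < s"
proof -
  define m where "m = Max (insert w {a \<in> A. a < u})"
  have "m < u" using assms unfolding m_def by (subst Max_less_iff) auto
  then obtain s where "m < s" "s < u" using dense by blast
  moreover have "w \<le> m" "\<And>a. a \<in> A \<Longrightarrow> a < u \<Longrightarrow> a \<le> m"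
    using assms unfolding m_def by (auto intro!: Max_ge)
  ultimately show thesis using that by (meson le_less_trans)
qed

text \<open>A bar from \<open>u\<close> to \<open>v\<close> starts within every neighbourhood of \<open>u\<close> and ends within every
  neighbourhood of \<open>v\<close>, so each box counts it.\<close>

lemma bars_at_le_box:
  assumes p: "barcode K T p" and "u < v" and m: "m \<in> box_values p u v"
  shows "int (card (bars_at K T u v)) \<le> m"
proof -
  have fin: "finite K" using p by (simp add: barcode_def)
  obtain I J where IJ: "connected I" "connected J" "I \<inter> J = {}" "u \<in> interior I" "v \<in> interior J"
    and m_eq: "m = int (pers_ext p (Sup I) (Inf J)) - int (pers_ext p (Inf I) (Inf J))
        - int (pers_ext p (Sup I) (Sup J)) + int (pers_ext p (Inf I) (Sup J))"
    using m unfolding box_values_def by blast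
  define i s t r where "i = Inf I" and "s = Sup I" and "t = Inf J" and "r = Sup J"
  have uI: "u \<in> I" and vJ: "v \<in> J" using IJ interior_subset by blast+
  have "s \<le> t" unfolding s_def t_def
    using disjoint_neighbourhoods_ordered[OF IJ(1-3) uI vJ \<open>u < v\<close>] .
  have "u < s" "t < v"
    unfolding s_def t_def using IJ interior_imp_less_Sup interior_imp_Inf_less \<open>u < v\<close> by auto
  have "i \<le> u" "v \<le> r" unfolding i_def r_def using uI vJ by (auto intro: Inf_lower Sup_upper)
  have iu: "i < u" if "u \<noteq> -\<infinity>"
    using interior_imp_Inf_less[OF IJ(4), of "-\<infinity>"] that unfolding i_def by simp
  have vr: "v < r" if "v \<noteq> \<infinity>"
    using interior_imp_less_Sup[OF IJ(5), of "\<infinity>"] that unfolding r_def by simp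
  have "i < \<infinity>" "s < \<infinity>" "-\<infinity> < t" "-\<infinity> < r"
    using \<open>s \<le> t\<close> \<open>u < s\<close> \<open>t < v\<close> \<open>i \<le> u\<close> \<open>v \<le> r\<close> by (auto simp: less_top)
  moreover have "i \<le> t" "i \<le> r" "s \<le> r"
    using \<open>s \<le> t\<close> \<open>u < s\<close> \<open>t < v\<close> \<open>i \<le> u\<close> \<open>v \<le> r\<close> by auto
  ultimately have "m = int (bar_count K T s t) - int (bar_count K T i t)
      - int (bar_count K T s r) + int (bar_count K T i r)"
    unfolding m_eq using pers_ext_eq_bar_count[OF p] \<open>s \<le> t\<close>
    by (simp add: i_def s_def t_def r_def)
  also have "\<dots> = (\<Sum>k\<in>K. (of_bool (starts_by (T k) s) - of_bool (starts_by (T k) i))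
              * (of_bool (lasts_to (T k) t) - of_bool (lasts_to (T k) r)))" (is "_ = sum ?g K")
    by (rule box_eq_sum[OF fin])
  finally have m_sum: "m = sum ?g K" .
  have g_ge: "of_bool (k \<in> bars_at K T u v) \<le> ?g k" for k
  proof -
    have "starts_by (T k) i \<Longrightarrow> starts_by (T k) s"
      using starts_by_mono \<open>i \<le> u\<close> \<open>u < s\<close> by (meson less_imp_le order_trans)
    moreover have "lasts_to (T k) r \<Longrightarrow> lasts_to (T k) t"
      using lasts_to_antimono \<open>v \<le> r\<close> \<open>t < v\<close> by (meson less_imp_le order_trans)
    moreover have "starts_by (T k) s \<and> \<not> starts_by (T k) i \<and> lasts_to (T k) t \<and> \<not> lasts_to (T k) r"
      if "k \<in> bars_at K T u v"
    proof -
      have e: "Inf (ereal ` T k) = u" "Sup (ereal ` T k) = v" "u \<noteq> -\<infinity>" "v \<noteq> \<infinity>"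
        using that by (auto simp: bars_at_def)
      then show ?thesis
        using Inf_less_imp_starts_by[of "T k" s] less_Sup_imp_lasts_to[of t "T k"]
          starts_by_imp_Inf_le[of "T k" i] lasts_to_imp_le_Sup[of "T k" r]
          \<open>u < s\<close> \<open>t < v\<close> iu vr by (auto simp: not_le[symmetric])
    qed
    ultimately show ?thesis by auto
  qed
  have "int (card (bars_at K T u v)) = (\<Sum>k\<in>K. of_bool (k \<in> bars_at K T u v))"
    using fin by (simp add: bars_at_def of_bool_def flip: sum.inter_filter)
  also have "\<dots> \<le> m" unfolding m_sum by (intro sum_mono g_ge)
  finally show ?thesis .
qed

text \<open>The minimum is attained by a box so small that bars starting in the neighbourhood of \<open>u\<close> start at \<open>u\<close>
  and bars ending in the neighbourhood of \<open>v\<close> end at \<open>v\<close>.\<close>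

lemma bars_at_is_box:
  assumes p: "barcode K T p" and "u < v"
  shows "int (card (bars_at K T u v)) \<in> box_values p u v"
proof -
  have fin: "finite K" using p by (simp add: barcode_def)
  define A B where "A = (\<lambda>k. Inf (ereal ` T k)) ` K" and "B = (\<lambda>k. Sup (ereal ` T k)) ` K"
  have AB: "finite A" "finite B" using fin by (auto simp: A_def B_def)
  obtain c where c: "u < c" "c < v" using dense[OF \<open>u < v\<close>] by blast
  obtain s where s: "u < s" "s < c" "\<And>a. a \<in> A \<Longrightarrow> u < a \<Longrightarrow> s < a"
    using gap_above[OF AB(1) c(1)] by blast
  obtain t where t: "c < t" "t < v" "\<And>b. b \<in> B \<Longrightarrow> b < v \<Longrightarrow> b < t"
    using gap_below[OF AB(2) c(2)] by blast
  obtain i where i: "u = -\<infinity> \<and> i = -\<infinity> \<or> i < u" "\<And>a. a \<in> A \<Longrightarrow> a < u \<Longrightarrow> a < i"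
  proof (cases "u = -\<infinity>")
    case True
    then show ?thesis using that by auto
  next
    case False
    then have "-\<infinity> < u" by simp
    then show ?thesis using gap_below[OF AB(1)] that by metis
  qed
  obtain r where r: "v = \<infinity> \<and> r = \<infinity> \<or> v < r" "\<And>b. b \<in> B \<Longrightarrow> v < b \<Longrightarrow> r < b"
  proof (cases "v = \<infinity>")
    case True
    then show ?thesis using that by auto
  next
    case False
    then have "v < \<infinity>" by simp
    then show ?thesis using gap_above[OF AB(2)] that by metis
  qed
  have le: "i \<le> u" "v \<le> r" "i \<le> s" "t \<le> r" "s \<le> t" "i \<le> t" "s \<le> r" "i \<le> r"
    using i(1) r(1) s(1,2) t(1,2) by auto
  have fin': "i < \<infinity>" "s < \<infinity>" "-\<infinity> < t" "-\<infinity> < r"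
    using le s(1,2) t(1,2) by (auto simp: less_top)
  have "u \<in> interior {i..s}"
  proof (cases "i < u")
    case True
    then show ?thesis
      using s(1) by (intro interiorI[of "{i<..<s}"]) (auto intro: less_imp_le)
  next
    case False
    then have "u = -\<infinity>" "i = -\<infinity>" using i(1) by auto
    then show ?thesis
      using s(1) by (intro interiorI[of "{..<s}"]) (auto intro: less_imp_le)
  qed
  moreover have "v \<in> interior {t..r}"
  proof (cases "v < r")
    case True
    then show ?thesis
      using t(2) by (intro interiorI[of "{t<..<r}"]) (auto intro: less_imp_le)
  next
    case False
    then have "v = \<infinity>" "r = \<infinity>" using r(1) by auto
    then show ?thesis
      using t(2) by (intro interiorI[of "{t<..}"]) (auto intro: less_imp_le)
  qed
  moreover have "{i..s} \<inter> {t..r} = {}" using s(2) t(1) by auto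
  ultimately have "int (pers_ext p (Sup {i..s}) (Inf {t..r})) - int (pers_ext p (Inf {i..s}) (Inf {t..r}))
        - int (pers_ext p (Sup {i..s}) (Sup {t..r})) + int (pers_ext p (Inf {i..s}) (Sup {t..r}))
        \<in> box_values p u v"
    unfolding box_values_def by (blast intro: connected_Icc)
  then have "int (bar_count K T s t) - int (bar_count K T i t)
      - int (bar_count K T s r) + int (bar_count K T i r) \<in> box_values p u v"
    using le fin' pers_ext_eq_bar_count[OF p] by simp
  moreover have "(of_bool (starts_by (T k) s) - of_bool (starts_by (T k) i))
              * (of_bool (lasts_to (T k) t) - of_bool (lasts_to (T k) r))
            = (of_bool (k \<in> bars_at K T u v) :: int)" if k: "k \<in> K" for k
  proof -
    define a b where "a = Inf (ereal ` T k)" and "b = Sup (ereal ` T k)"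
    have "a \<in> A" "b \<in> B" using k by (auto simp: A_def B_def a_def b_def)
    have st: "starts_by (T k) s \<longleftrightarrow> a \<le> u"
      using s starts_by_imp_Inf_le[of "T k" s] Inf_less_imp_starts_by[of "T k" s] \<open>a \<in> A\<close>
      unfolding a_def by (meson leD le_less_trans not_le)
    have la: "lasts_to (T k) t \<longleftrightarrow> v \<le> b"
      using t lasts_to_imp_le_Sup[of "T k" t] less_Sup_imp_lasts_to[of t "T k"] \<open>b \<in> B\<close>
      unfolding b_def by (meson leD less_le_trans not_le)
    have sti: "starts_by (T k) i \<longleftrightarrow> a < u \<or> a = -\<infinity>"
    proof (cases "i < u")
      case True
      then have "starts_by (T k) i \<Longrightarrow> a < u"
        using starts_by_imp_Inf_le le_less_trans unfolding a_def by blast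
      moreover have "a < u \<Longrightarrow> starts_by (T k) i"
        using i(2)[OF \<open>a \<in> A\<close>] Inf_less_imp_starts_by unfolding a_def by blast
      ultimately show ?thesis using starts_by_def[of "T k" i] unfolding a_def by blast
    next
      case False
      then show ?thesis using i(1) unfolding a_def by auto
    qed
    have lar: "lasts_to (T k) r \<longleftrightarrow> v < b \<or> b = \<infinity>"
    proof (cases "v < r")
      case True
      then have "lasts_to (T k) r \<Longrightarrow> v < b"
        using lasts_to_imp_le_Sup less_le_trans unfolding b_def by blast
      moreover have "v < b \<Longrightarrow> lasts_to (T k) r"
        using r(2)[OF \<open>b \<in> B\<close>] less_Sup_imp_lasts_to unfolding b_def by blast
      ultimately show ?thesis using lasts_to_def[of "T k" r] unfolding b_def by blast
    next
      case False
      then show ?thesis using r(1) unfolding b_def by auto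
    qed
    have "u \<noteq> \<infinity>" "v \<noteq> -\<infinity>" using \<open>u < v\<close> by auto
    then have "k \<in> bars_at K T u v \<longleftrightarrow> a = u \<and> b = v \<and> u \<noteq> -\<infinity> \<and> v \<noteq> \<infinity>"
      using k by (cases u; cases v) (auto simp: bars_at_def a_def b_def)
    then show ?thesis unfolding st la sti lar by auto
  qed
  moreover have "int (card (bars_at K T u v)) = (\<Sum>k\<in>K. of_bool (k \<in> bars_at K T u v))"
    using fin by (simp add: bars_at_def of_bool_def flip: sum.inter_filter)
  ultimately show ?thesis by (simp add: box_eq_sum[OF fin])
qed

lemma multiplicity_at_barcode:
  assumes "barcode K T p" "u < v"
  shows "multiplicity_at p (u, v) = enat (card (bars_at K T u v))"
proof -
  have "(LEAST m. m \<in> box_values p u v) = int (card (bars_at K T u v))"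
    by (rule Least_equality)
      (use assms bars_at_is_box bars_at_le_box in \<open>blast+\<close>)
  then show ?thesis using assms(2) by (simp add: multiplicity_at_def)
qed

section \<open>Matching bars that erode into each other\<close>

text \<open>\<^term>\<open>T\<close> survives in \<^term>\<open>T'\<close> up to a loss of \<open>\<epsilon>\<close> at either end. Two points closer than \<open>2\<epsilon>\<close> guarantee
  nothing, since the loss on both sides can consume them.\<close>

definition eroded_in :: "real \<Rightarrow> real set \<Rightarrow> real set \<Rightarrow> bool" where
  "eroded_in \<epsilon> T T' \<longleftrightarrow>
     (\<forall>x\<in>T. \<forall>y\<in>T. x + 2 * \<epsilon> \<le> y \<longrightarrow> (\<exists>x'\<in>T'. x' \<le> x + \<epsilon>) \<and> (\<exists>y'\<in>T'. y - \<epsilon> \<le> y'))"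

lemma Inf_Sup_real:
  assumes "T \<noteq> {}" "\<And>x. x \<in> T \<Longrightarrow> l \<le> x \<and> x \<le> u"
  shows "Inf (ereal ` T) = ereal (Inf T)" "Sup (ereal ` T) = ereal (Sup T)"
    "l \<le> Inf T" "Sup T \<le> u" "x \<in> T \<Longrightarrow> Inf T \<le> x" "x \<in> T \<Longrightarrow> x \<le> Sup T"
proof -
  have bdd: "bdd_below T" "bdd_above T" using assms(2) by (meson bdd_belowI bdd_aboveI)+
  obtain x0 where x0: "x0 \<in> T" using assms(1) by blast
  have "ereal x0 \<le> Sup (ereal ` T)" "Sup (ereal ` T) \<le> ereal u"
    using x0 assms(2) by (auto intro!: SUP_upper SUP_least)
  then have "\<bar>Sup (ereal ` T)\<bar> \<noteq> \<infinity>" by auto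
  then show "Sup (ereal ` T) = ereal (Sup T)" by (simp add: ereal_Sup)
  show "Inf (ereal ` T) = ereal (Inf T)" using ereal_Inf'[OF bdd(1) assms(1)] by simp
  show "l \<le> Inf T" "Sup T \<le> u" using assms by (auto intro!: cInf_greatest cSup_least)
  show "x \<in> T \<Longrightarrow> Inf T \<le> x" "x \<in> T \<Longrightarrow> x \<le> Sup T" using bdd by (auto intro: cInf_lower cSup_upper)
qed

text \<open>Erosion of \<open>T\<close> puts points of \<open>T'\<close> close to both ends of the bar. A point of \<open>T'\<close> more than \<open>\<epsilon>\<close>
  beyond one end is more than \<open>2\<epsilon>\<close> away from the surviving point near the other end, so erosion in
  the reverse direction would put a point of \<open>T\<close> outside its own bounds.\<close>

lemma long_bar_endpoints_close:
  assumes TT': "eroded_in \<epsilon> T T'" and T'T: "eroded_in \<epsilon> T' T" and "0 \<le> \<epsilon>"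
    and ab: "Inf (ereal ` T) = ereal a" "Sup (ereal ` T) = ereal b" and long: "2 * \<epsilon> < b - a"
  obtains a' b' where "Inf (ereal ` T') = ereal a'" "Sup (ereal ` T') = ereal b'" "a' < b'"
    "\<bar>a - a'\<bar> \<le> \<epsilon>" "\<bar>b - b'\<bar> \<le> \<epsilon>"
proof -
  have T: "a \<le> x \<and> x \<le> b" if "x \<in> T" for x
    using that ab by (metis INF_lower SUP_upper ereal_less_eq(3))
  have near_a: "\<exists>x\<in>T. x < c" if "a < c" for c
  proof -
    have "Inf (ereal ` T) < ereal c" using ab that by simp
    then show ?thesis by (auto simp: Inf_less_iff)
  qed
  have near_b: "\<exists>x\<in>T. c < x" if "c < b" for c
  proof -
    have "ereal c < Sup (ereal ` T)" using ab that by simp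
    then show ?thesis by (auto simp: less_Sup_iff)
  qed
  \<comment> \<open>Points of \<open>T\<close> arbitrarily close to both ends give points of \<open>T'\<close> by erosion.\<close>
  have ends: "\<exists>x'\<in>T'. \<exists>y'\<in>T'. x' < a + \<epsilon> + \<delta> \<and> b - \<epsilon> - \<delta> < y'" if "0 < \<delta>" for \<delta>
  proof -
    \<comment> \<open>Points within \<open>d\<close> of the two ends are still at least \<open>2\<epsilon>\<close> apart.\<close>
    define d where "d = min \<delta> ((b - a - 2 * \<epsilon>) / 2)"
    have d: "0 < d" "d \<le> \<delta>" "2 * d \<le> b - a - 2 * \<epsilon>"
      using that long by (auto simp: d_def min_def)
    obtain x where x: "x \<in> T" "x < a + d" using near_a[of "a + d"] d by auto
    obtain y where y: "y \<in> T" "b - d < y" using near_b[of "b - d"] d by auto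
    have "x + 2 * \<epsilon> \<le> y" using x y d by linarith
    then obtain x' y' where "x' \<in> T'" "x' \<le> x + \<epsilon>" "y' \<in> T'" "y - \<epsilon> \<le> y'"
      using TT' x y unfolding eroded_in_def by blast
    moreover from this have "x' < a + \<epsilon> + \<delta>" "b - \<epsilon> - \<delta> < y'" using x y d by linarith+
    ultimately show ?thesis by blast
  qed
  obtain x0 y0 where x0: "x0 \<in> T'" "x0 < b - \<epsilon>" and y0: "y0 \<in> T'" "a + \<epsilon> < y0"
  proof -
    \<comment> \<open>For this \<open>\<delta>\<close> the bounds \<open>a + \<epsilon> + \<delta>\<close> and \<open>b - \<epsilon> - \<delta>\<close> are \<open>b - \<epsilon>\<close> and \<open>a + \<epsilon>\<close>.\<close>
    have "0 < b - a - 2 * \<epsilon>" using long by simp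
    from ends[OF this] obtain x' y' where
      "x' \<in> T'" "y' \<in> T'" "x' < a + \<epsilon> + (b - a - 2 * \<epsilon>)" "b - \<epsilon> - (b - a - 2 * \<epsilon>) < y'" by blast
    then show ?thesis by (intro that[of x' y']) auto
  qed
  have T': "a - \<epsilon> \<le> x \<and> x \<le> b + \<epsilon>" if x: "x \<in> T'" for x
  proof (rule ccontr)
    assume "\<not> (a - \<epsilon> \<le> x \<and> x \<le> b + \<epsilon>)"
    then consider "x < a - \<epsilon>" | "b + \<epsilon> < x" by linarith
    then show False
    proof cases
      case 1
      then have "x + 2 * \<epsilon> \<le> y0" using y0 by linarith
      then obtain z where "z \<in> T" "z \<le> x + \<epsilon>" using T'T x y0 unfolding eroded_in_def by blast
      then show False using T[of z] 1 by linarith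
    next
      case 2
      then have "x0 + 2 * \<epsilon> \<le> x" using x0 by linarith
      then obtain z where "z \<in> T" "x - \<epsilon> \<le> z" using T'T x x0 unfolding eroded_in_def by blast
      then show False using T[of z] 2 by linarith
    qed
  qed
  have ne: "T' \<noteq> {}" using x0 by blast
  note IS = Inf_Sup_real[OF ne T']
  have "Inf T' \<le> a + \<epsilon> + \<delta>" "b - \<epsilon> - \<delta> \<le> Sup T'" if "0 < \<delta>" for \<delta>
    using ends[OF that] IS(5,6) by fastforce+
  then have "Inf T' \<le> a + \<epsilon>" "b - \<epsilon> \<le> Sup T'"
    using field_le_epsilon[of "Inf T'" "a + \<epsilon>"] field_le_epsilon[of "b - \<epsilon>" "Sup T'"]
    by (auto simp: algebra_simps)
  then show thesis using that[OF IS(1,2)] IS(3,4) long by (auto simp: abs_le_iff)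
qed

lemma bij_betw_labelled_copies:
  fixes m :: "'c \<Rightarrow> enat"
  assumes "\<And>c. \<exists>f. bij_betw f {w \<in> W. l w = c} {i. enat i < m c}"
  obtains \<beta> where "bij_betw \<beta> W {(c, i). enat i < m c}" "\<And>w. w \<in> W \<Longrightarrow> fst (\<beta> w) = l w"
proof -
  obtain f where f: "\<And>c. bij_betw (f c) {w \<in> W. l w = c} {i. enat i < m c}"
    using assms by metis
  let ?\<beta> = "\<lambda>w. (l w, f (l w) w)"
  have "inj_on ?\<beta> W"
  proof (rule inj_onI)
    fix w w' assume w: "w \<in> W" "w' \<in> W" and eq: "?\<beta> w = ?\<beta> w'"
    have l: "l w' = l w" using eq by (rule Pair_inject) (rule sym)
    have "f (l w) w = f (l w) w'" using eq unfolding l by (rule Pair_inject)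
    moreover have "w \<in> {x \<in> W. l x = l w}" "w' \<in> {x \<in> W. l x = l w}" using w l by blast+
    ultimately show "w = w'" by (rule inj_onD[OF bij_betw_imp_inj_on[OF f]])
  qed
  moreover have "?\<beta> ` W = {(c, i). enat i < m c}"
  proof (intro equalityI subsetI)
    fix z assume "z \<in> ?\<beta> ` W"
    then obtain w where "w \<in> W" "z = ?\<beta> w" by blast
    then show "z \<in> {(c, i). enat i < m c}" using bij_betwE[OF f[of "l w"]] by simp
  next
    fix z assume "z \<in> {(c, i). enat i < m c}"
    then obtain c i where z: "z = (c, i)" "enat i < m c" by blast
    then have "i \<in> f c ` {w \<in> W. l w = c}"
      unfolding bij_betw_imp_surj_on[OF f[of c]] by simp
    then obtain w where w: "w \<in> W" "l w = c" "i = f c w" by blast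
    have "z = ?\<beta> w" unfolding z(1) w(2) w(3) by (rule refl)
    then show "z \<in> ?\<beta> ` W" using w(1) by (rule image_eqI)
  qed
  ultimately have "bij_betw ?\<beta> W {(c, i). enat i < m c}" by (simp add: bij_betw_def)
  then show thesis using that by simp
qed

text \<open>A bijection of diagrams is given by a set \<open>W\<close> of pairs of points \<open>(l w, r w)\<close> in which each point
  occurs on either side as often as its multiplicity. Which labelled copy is used is irrelevant for
  the distance, so the copies may be distributed arbitrarily within each fibre.\<close>

lemma bottleneck_le_via_pairing:
  assumes l: "\<And>c. \<exists>f. bij_betw f {w \<in> W. l w = c} {i. enat i < multiplicity_at p c}"
    and r: "\<And>c. \<exists>f. bij_betw f {w \<in> W. r w = c} {i. enat i < multiplicity_at p' c}"
    and close: "\<And>w. w \<in> W \<Longrightarrow> linf_dist (l w) (r w) \<le> \<epsilon>"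
  shows "bottleneck p p' \<le> \<epsilon>"
proof -
  obtain \<beta> where \<beta>: "bij_betw \<beta> W (Dgm p)" "\<And>w. w \<in> W \<Longrightarrow> fst (\<beta> w) = l w"
    using bij_betw_labelled_copies[OF l] unfolding Dgm_def by blast
  obtain \<beta>' where \<beta>': "bij_betw \<beta>' W (Dgm p')" "\<And>w. w \<in> W \<Longrightarrow> fst (\<beta>' w) = r w"
    using bij_betw_labelled_copies[OF r] unfolding Dgm_def by blast
  let ?\<gamma> = "\<beta>' \<circ> inv_into W \<beta>"
  have "bij_betw ?\<gamma> (Dgm p) (Dgm p')"
    using bij_betw_inv_into[OF \<beta>(1)] \<beta>'(1) by (rule bij_betw_trans)
  moreover have "linf_dist (fst c) (fst (?\<gamma> c)) \<le> \<epsilon>" if c: "c \<in> Dgm p" for c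
  proof -
    obtain w where w: "w \<in> W" "c = \<beta> w"
      using c bij_betw_imp_surj_on[OF \<beta>(1)] by blast
    then have "inv_into W \<beta> c = w" using \<beta>(1) by (simp add: bij_betw_inv_into_left)
    then show ?thesis using w \<beta> \<beta>' close by simp
  qed
  ultimately show ?thesis
    unfolding bottleneck_def by (intro INF_lower2[of ?\<gamma>] SUP_least) auto
qed

definition finite_bars :: "'k set \<Rightarrow> ('k \<Rightarrow> real set) \<Rightarrow> 'k set" where
  "finite_bars K T = {k \<in> K. \<exists>a b. Inf (ereal ` T k) = ereal a \<and> Sup (ereal ` T k) = ereal b \<and> a < b}"

definition bar_point :: "real set \<Rightarrow> ereal \<times> ereal" where
  "bar_point T = (Inf (ereal ` T), Sup (ereal ` T))"

text \<open>The point of the diagonal nearest to a bar with finite ends.\<close>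

definition bar_midpoint :: "real set \<Rightarrow> ereal \<times> ereal" where
  "bar_midpoint T =
     (let m = ereal ((real_of_ereal (Inf (ereal ` T)) + real_of_ereal (Sup (ereal ` T))) / 2) in (m, m))"

text \<open>The index set consists of finitely many pairs \<open>K0\<close> and of countably many copies of each
  diagonal point. Pairs of \<open>K0\<close> outside \<open>B\<close> have their point on the diagonal, where the fibre is
  countably infinite with or without them.\<close>

lemma fibre_has_multiplicity:
  assumes p: "barcode K T p"
    and W: "W = Inl ` K0 \<union> range Inr" and fin: "finite K0" and "B \<subseteq> K0"
    and h: "bij_betw h B (finite_bars K T)"
    and bar: "\<And>k. k \<in> B \<Longrightarrow> l (Inl k) = bar_point (T (h k))"
    and mid: "\<And>k. k \<in> K0 - B \<Longrightarrow> fst (l (Inl k)) = snd (l (Inl k))"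
    and diag: "\<And>x n. l (Inr (x, n :: nat)) = (x, x)"
  shows "\<exists>f. bij_betw f {w \<in> W. l w = c} {i. enat i < multiplicity_at p c}"
proof -
  obtain u v where c: "c = (u, v)" by fastforce
  show ?thesis
  proof (cases "u = v")
    case True
    let ?S = "{w \<in> W. l w = c}"
    have "?S \<subseteq> Inl ` K0 \<union> range (\<lambda>n::nat. Inr (u, n))"
      using W True diag c by auto
    moreover have "countable (Inl ` K0 \<union> range (\<lambda>n::nat. Inr (u, n)))"
      using countable_finite[OF finite_imageI[OF fin]] by (intro countable_Un) simp_all
    ultimately have "countable ?S" by (rule countable_subset)
    moreover have "infinite ?S"
    proof -
      have "range (\<lambda>n::nat. Inr (u, n)) \<subseteq> ?S" using W True diag c by auto
      moreover have "infinite (range (\<lambda>n::nat. Inr (u, n) :: 'b + ereal \<times> nat))"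
        by (rule range_inj_infinite) (auto intro: injI)
      ultimately show ?thesis using finite_subset by blast
    qed
    ultimately have "bij_betw (to_nat_on ?S) ?S UNIV" by (rule to_nat_on_infinite)
    then show ?thesis using True c by (auto simp: multiplicity_at_def)
  next
    case False
    let ?S = "{k \<in> B. bar_point (T (h k)) = c}" and ?S' = "{k \<in> finite_bars K T. bar_point (T k) = c}"
    have fibre_eq: "{w \<in> W. l w = c} = Inl ` ?S"
    proof (intro equalityI subsetI)
      fix w assume w: "w \<in> {w \<in> W. l w = c}"
      then consider k where "k \<in> K0" "w = Inl k" | x n where "w = Inr (x, n)" using W by auto
      then show "w \<in> Inl ` ?S"
      proof cases
        case 1
        then have "k \<in> B" using w mid[of k] False c by auto
        then show ?thesis using 1 w bar by auto
      next
        case 2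
        then show ?thesis using w False c diag by auto
      qed
    next
      fix w :: "'b + ereal \<times> nat" assume "w \<in> Inl ` ?S"
      then obtain k where k: "w = Inl k" "k \<in> B" "bar_point (T (h k)) = c" by blast
      then have "k \<in> K0" "l (Inl k) = c" using \<open>B \<subseteq> K0\<close> bar[of k] by auto
      then show "w \<in> {w \<in> W. l w = c}" unfolding k(1) W by blast
    qed
    have "finite ?S" using finite_subset[OF \<open>B \<subseteq> K0\<close> fin] by simp
    have bij_h: "bij_betw h ?S ?S'"
    proof (rule bij_betw_imageI)
      show "inj_on h ?S" using bij_betw_imp_inj_on[OF h] by (rule inj_on_subset) auto
      show "h ` ?S = ?S'" unfolding bij_betw_imp_surj_on[OF h, symmetric] by blast
    qed
    have fibre: "finite {w \<in> W. l w = c}" "card {w \<in> W. l w = c} = card ?S'"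
      unfolding fibre_eq bij_betw_same_card[OF bij_h, symmetric]
      by (rule finite_imageI[OF \<open>finite ?S\<close>]) (rule card_image, simp)
    have "multiplicity_at p c = enat (card ?S')"
    proof (cases "u < v")
      case True
      have "?S' = bars_at K T u v"
        using True by (cases u; cases v) (auto simp: finite_bars_def bars_at_def bar_point_def c)
      then show ?thesis using multiplicity_at_barcode[OF p True] c by simp
    next
      case notless: False
      then have "?S' = {}" using False by (auto simp: finite_bars_def bar_point_def c)
      then have "card ?S' = 0" by (simp only: card.empty)
      then show ?thesis using False notless c by (simp add: multiplicity_at_def zero_enat_def)
    qed
    then have "{i. enat i < multiplicity_at p c} = {0..<card ?S'}" by auto
    then show ?thesis using ex_bij_betw_finite_nat[OF fibre(1)] unfolding fibre(2) by simp
  qed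
qed

lemma linf_dist_real:
  "linf_dist (ereal a, ereal b) (ereal a', ereal b') = ereal (max \<bar>a - a'\<bar> \<bar>b - b'\<bar>)"
proof -
  have "ext_dist (ereal x) (ereal y) = ereal \<bar>x - y\<bar>" for x y
    by (simp add: ext_dist_def)
  then show ?thesis by (simp add: linf_dist_def max_def)
qed

lemma linf_dist_commute: "linf_dist c c' = linf_dist c' c"
proof -
  have "ext_dist x y = ext_dist y x" for x y
    by (cases x; cases y) (auto simp: ext_dist_def)
  then show ?thesis by (simp add: linf_dist_def)
qed

text \<open>Bars with close ends are paired with each other, and every remaining finite bar is short by
  \<open>long_bar_endpoints_close\<close> and is paired with its midpoint. An index whose two bars are both finite
  and not paired gives rise to two such pairs, one for each diagram; a Boolean tag distinguishes
  them.\<close>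

theorem bottleneck_le_of_eroded_bars:
  assumes p: "barcode K T p" and p': "barcode K T' p'" and "0 \<le> \<epsilon>"
    and er: "\<And>k. k \<in> K \<Longrightarrow> eroded_in \<epsilon> (T k) (T' k)"
    and er': "\<And>k. k \<in> K \<Longrightarrow> eroded_in \<epsilon> (T' k) (T k)"
  shows "bottleneck p p' \<le> ereal \<epsilon>"
proof -
  define M M' where "M = finite_bars K T" and "M' = finite_bars K T'"
  define paired where
    "paired = {k \<in> M \<inter> M'. linf_dist (bar_point (T k)) (bar_point (T' k)) \<le> ereal \<epsilon>}"
  have short: "linf_dist (bar_point (S k)) (bar_midpoint (S k)) \<le> ereal \<epsilon>"
    if k: "k \<in> finite_bars K S" "k \<notin> finite_bars K S' \<or> \<not> linf_dist (bar_point (S k)) (bar_point (S' k)) \<le> ereal \<epsilon>"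
      and e: "eroded_in \<epsilon> (S k) (S' k)" "eroded_in \<epsilon> (S' k) (S k)" for S S' :: "'a \<Rightarrow> real set" and k
  proof -
    obtain a b where ab: "Inf (ereal ` S k) = ereal a" "Sup (ereal ` S k) = ereal b" "a < b" "k \<in> K"
      using k(1) by (auto simp: finite_bars_def)
    have "\<not> 2 * \<epsilon> < b - a"
    proof
      assume "2 * \<epsilon> < b - a"
      from long_bar_endpoints_close[OF e \<open>0 \<le> \<epsilon>\<close> ab(1,2) this]
      obtain a' b' where "Inf (ereal ` S' k) = ereal a'" "Sup (ereal ` S' k) = ereal b'" "a' < b'"
        "\<bar>a - a'\<bar> \<le> \<epsilon>" "\<bar>b - b'\<bar> \<le> \<epsilon>" by blast
      then show False using k(2) ab by (auto simp: finite_bars_def bar_point_def linf_dist_real)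
    qed
    then show ?thesis
      using ab by (auto simp: bar_point_def bar_midpoint_def Let_def linf_dist_real field_simps abs_le_iff)
  qed
  define K0 where "K0 = M \<times> {True} \<union> (M' - paired) \<times> {False}"
  define W :: "('a \<times> bool + ereal \<times> nat) set" where "W = Inl ` K0 \<union> range Inr"
  define l where "l = case_sum
     (\<lambda>(k, is_left). if is_left then bar_point (T k) else bar_midpoint (T' k))
     (\<lambda>(x, n :: nat). (x, x))"
  define r where "r = case_sum
     (\<lambda>(k, is_left). if is_left \<and> k \<notin> paired then bar_midpoint (T k) else bar_point (T' k))
     (\<lambda>(x, n :: nat). (x, x))"
  have fin: "finite K0"
    using p by (auto simp: K0_def M_def M'_def finite_bars_def barcode_def)
  have mid: "fst (bar_midpoint S) = snd (bar_midpoint S)" for S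
    by (simp add: bar_midpoint_def Let_def)
  show ?thesis
  proof (rule bottleneck_le_via_pairing)
    show "\<exists>f. bij_betw f {w \<in> W. l w = c} {i. enat i < multiplicity_at p c}" for c
    proof (rule fibre_has_multiplicity[OF p W_def fin, where B = "M \<times> {True}" and h = fst])
      show "bij_betw fst (M \<times> {True}) (finite_bars K T)"
        by (auto simp: bij_betw_def M_def intro: inj_onI)
    qed (auto simp: K0_def l_def mid)
    show "\<exists>f. bij_betw f {w \<in> W. r w = c} {i. enat i < multiplicity_at p' c}" for c
    proof (rule fibre_has_multiplicity[OF p' W_def fin, where h = fst
          and B = "paired \<times> {True} \<union> (M' - paired) \<times> {False}"])
      have "paired \<subseteq> M'" by (auto simp: paired_def)
      then show "bij_betw fst (paired \<times> {True} \<union> (M' - paired) \<times> {False}) (finite_bars K T')"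
        by (auto simp: bij_betw_def image_Un simp flip: M'_def intro: inj_onI)
    qed (auto simp: K0_def r_def mid paired_def)
    show "linf_dist (l w) (r w) \<le> ereal \<epsilon>" if "w \<in> W" for w
    proof -
      consider x n where "w = Inr (x, n)" | k where "w = Inl (k, True)" "k \<in> paired"
        | k where "w = Inl (k, True)" "k \<in> M - paired"
        | k where "w = Inl (k, False)" "k \<in> M' - paired"
        using \<open>w \<in> W\<close> unfolding W_def K0_def by auto
      then show ?thesis
      proof cases
        case 1
        then show ?thesis using \<open>0 \<le> \<epsilon>\<close> by (simp add: l_def r_def linf_dist_def ext_dist_def)
      next
        case 2
        then show ?thesis by (simp add: l_def r_def paired_def)
      next
        case 3
        then have "k \<in> K" by (simp add: M_def finite_bars_def)
        then show ?thesis
          using 3 short[of k T T'] er er' by (auto simp: l_def r_def paired_def M_def M'_def)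
      next
        case 4
        then have "k \<in> K" by (simp add: M'_def finite_bars_def)
        moreover have "k \<notin> M \<or> \<not> linf_dist (bar_point (T' k)) (bar_point (T k)) \<le> ereal \<epsilon>"
          using 4 linf_dist_commute[of "bar_point (T' k)" "bar_point (T k)"]
          by (auto simp: paired_def)
        ultimately have "linf_dist (bar_point (T' k)) (bar_midpoint (T' k)) \<le> ereal \<epsilon>"
          using 4 short[of k T' T] er er' unfolding M_def M'_def by blast
        then show ?thesis
          using 4 linf_dist_commute[of "bar_midpoint (T' k)" "bar_point (T' k)"]
          by (simp add: l_def r_def)
      qed
    qed
  qed
qed

section \<open>Objects over a finite set\<close>

locale concrete_mono_category =
  fixes C :: "('o, 'm) cat" and \<Phi> :: "('o, 'm, 'a) concretion"
  assumes finitely_concrete: "finitely_concrete_mono_category C \<Phi>"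
begin

abbreviation fib :: "'o \<Rightarrow> 'a set" where "fib \<equiv> onObj \<Phi>"

definition act :: "'m \<Rightarrow> 'a \<Rightarrow> 'a" where "act f = fst (snd (onArr \<Phi> f))"

lemma category_C: "category C" and functor_Phi: "is_functor C FinSet_m \<Phi>"
  and mono_C: "f \<in> Arr C \<Longrightarrow> monomorphism C f"
  using finitely_concrete
  by (auto simp: finitely_concrete_mono_category_def mono_category_def)

lemma hom_set_Obj: "f \<in> hom_set C X Y \<Longrightarrow> X \<in> Obj C" "f \<in> hom_set C X Y \<Longrightarrow> Y \<in> Obj C"
  using category_C by (auto simp: category_def hom_set_def)

lemma Ident_in_hom_set: "X \<in> Obj C \<Longrightarrow> Ident C X \<in> hom_set C X X"
  using category_C by (auto simp: category_def)

lemma Cmp_in_hom_set: "f \<in> hom_set C X Y \<Longrightarrow> g \<in> hom_set C Y Z \<Longrightarrow> Cmp C g f \<in> hom_set C X Z"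
  using category_C unfolding category_def hom_set_def by auto

lemma Cmp_Ident:
  "f \<in> hom_set C X Y \<Longrightarrow> Cmp C f (Ident C X) = f"
  "f \<in> hom_set C X Y \<Longrightarrow> Cmp C (Ident C Y) f = f"
  using category_C unfolding category_def hom_set_def by auto

lemma Cmp_assoc:
  "f \<in> hom_set C W X \<Longrightarrow> g \<in> hom_set C X Y \<Longrightarrow> h \<in> hom_set C Y Z \<Longrightarrow>
    Cmp C h (Cmp C g f) = Cmp C (Cmp C h g) f"
  using category_C unfolding category_def hom_set_def by auto

lemma isomorphismI:
  "f \<in> hom_set C X Y \<Longrightarrow> g \<in> hom_set C Y X \<Longrightarrow> Cmp C g f = Ident C X \<Longrightarrow>
    Cmp C f g = Ident C Y \<Longrightarrow> isomorphism C f"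
  unfolding isomorphism_def hom_set_def by auto

lemma isomorphismE:
  assumes "isomorphism C f" "f \<in> hom_set C X Y"
  obtains g where "g \<in> hom_set C Y X" "Cmp C g f = Ident C X" "Cmp C f g = Ident C Y"
  using assms unfolding isomorphism_def hom_set_def by auto

lemma isomorphism_Ident: "X \<in> Obj C \<Longrightarrow> isomorphism C (Ident C X)"
  using Ident_in_hom_set Cmp_Ident by (blast intro: isomorphismI)

lemma isomorphism_Cmp:
  assumes f: "f \<in> hom_set C X Y" "isomorphism C f" and g: "g \<in> hom_set C Y Z" "isomorphism C g"
  shows "isomorphism C (Cmp C g f)"
proof -
  obtain f' where f': "f' \<in> hom_set C Y X" "Cmp C f' f = Ident C X" "Cmp C f f' = Ident C Y"
    using isomorphismE f by blast
  obtain g' where g': "g' \<in> hom_set C Z Y" "Cmp C g' g = Ident C Y" "Cmp C g g' = Ident C Z"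
    using isomorphismE g by blast
  note h = f(1) f'(1) g(1) g'(1) Cmp_in_hom_set[OF f(1) g(1)] Cmp_in_hom_set[OF g'(1) f'(1)]
  have "Cmp C (Cmp C f' g') (Cmp C g f) = Cmp C f' (Cmp C (Cmp C g' g) f)"
    using Cmp_assoc[OF h(5) h(4) h(2)] Cmp_assoc[OF h(1) h(3) h(4)] by simp
  moreover have "Cmp C (Cmp C g f) (Cmp C f' g') = Cmp C g (Cmp C (Cmp C f f') g')"
    using Cmp_assoc[OF h(6) h(1) h(3)] Cmp_assoc[OF h(4) h(2) h(1)] by simp
  ultimately show ?thesis
    using isomorphismI[OF h(5,6)] f' g' Cmp_Ident h by simp
qed

text \<open>The hypothesis gives \<open>g\<close> a right inverse \<open>r\<close>, and \<open>g\<close> can be cancelled from \<open>g r g = g\<close> as it is a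
  monomorphism.\<close>

lemma isomorphism_of_split_epi:
  assumes f: "f \<in> hom_set C X Y" and g: "g \<in> hom_set C Y Z" and iso: "isomorphism C (Cmp C g f)"
  shows "isomorphism C g"
proof -
  obtain h where h: "h \<in> hom_set C Z X" "Cmp C (Cmp C g f) h = Ident C Z"
    using isomorphismE[OF iso Cmp_in_hom_set[OF f g]] by blast
  define r where "r = Cmp C f h"
  have r: "r \<in> hom_set C Z Y" unfolding r_def using h(1) f by (rule Cmp_in_hom_set)
  have gr: "Cmp C g r = Ident C Z" unfolding r_def Cmp_assoc[OF h(1) f g] by (rule h(2))
  have "Cmp C g (Cmp C r g) = Cmp C g (Ident C Y)"
    using Cmp_assoc[OF g r g] gr Cmp_Ident[OF g] by simp
  moreover have "monomorphism C g" "Dom C g = Y"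
    using g mono_C by (auto simp: hom_set_def)
  ultimately have "Cmp C r g = Ident C Y"
    using Cmp_in_hom_set[OF g r] Ident_in_hom_set hom_set_Obj[OF g]
    unfolding monomorphism_def by blast
  then show ?thesis using isomorphismI[OF g r] gr by blast
qed

lemma onArr_in_FinSet:
  "f \<in> hom_set C X Y \<Longrightarrow> onArr \<Phi> f \<in> hom_set FinSet_m (fib X) (fib Y)"
  using functor_Phi unfolding is_functor_def hom_set_def by auto

lemma onArr_eq: "f \<in> hom_set C X Y \<Longrightarrow> onArr \<Phi> f = (fib X, act f, fib Y)"
  using onArr_in_FinSet[of f X Y]
  by (auto simp: act_def hom_set_def FinSet_m_def split: prod.splits)

lemma finite_fib: "X \<in> Obj C \<Longrightarrow> finite (fib X)"
  using functor_Phi by (auto simp: is_functor_def FinSet_m_def)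

lemma act_in_fib: "f \<in> hom_set C X Y \<Longrightarrow> x \<in> fib X \<Longrightarrow> act f x \<in> fib Y"
  using onArr_in_FinSet[of f X Y] onArr_eq[of f X Y] by (auto simp: hom_set_def FinSet_m_def)

lemma act_inj_on: "f \<in> hom_set C X Y \<Longrightarrow> inj_on (act f) (fib X)"
  using onArr_in_FinSet[of f X Y] onArr_eq[of f X Y] by (auto simp: hom_set_def FinSet_m_def)

lemma act_Ident: "X \<in> Obj C \<Longrightarrow> x \<in> fib X \<Longrightarrow> act (Ident C X) x = x"
  using functor_Phi by (auto simp: is_functor_def act_def FinSet_m_def)

lemma act_Cmp:
  assumes f: "f \<in> hom_set C X Y" and g: "g \<in> hom_set C Y Z" and x: "x \<in> fib X"
  shows "act (Cmp C g f) x = act g (act f x)"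
proof -
  have "onArr \<Phi> (Cmp C g f) = Cmp FinSet_m (onArr \<Phi> g) (onArr \<Phi> f)"
    using functor_Phi f g unfolding is_functor_def hom_set_def by auto
  also have "\<dots> = (fib X, compose (fib X) (act g) (act f), fib Z)"
    by (simp add: onArr_eq[OF f] onArr_eq[OF g] FinSet_m_def)
  finally show ?thesis using x by (simp add: act_def compose_def)
qed

lemma isomorphism_act_surj:
  assumes "isomorphism C f" and f: "f \<in> hom_set C X Y"
  shows "act f ` fib X = fib Y"
proof
  show "act f ` fib X \<subseteq> fib Y" using act_in_fib[OF f] by blast
  obtain g where g: "g \<in> hom_set C Y X" "Cmp C f g = Ident C Y"
    using isomorphismE[OF assms] by blast
  show "fib Y \<subseteq> act f ` fib X"
  proof
    fix y assume y: "y \<in> fib Y"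
    then have "act f (act g y) = y"
      using act_Cmp[OF g(1) f] act_Ident[OF hom_set_Obj(2)[OF f]] g(2) by simp
    then show "y \<in> act f ` fib X" using act_in_fib[OF g(1) y] by (metis imageI)
  qed
qed

lemma push_eq: "f \<in> hom_set C X Y \<Longrightarrow> push C \<Phi> f (A, X) = (act f ` A, Y)"
  by (simp add: push_def act_def hom_set_def)

text \<open>Objects are considered together with an embedding of their underlying sets into a fixed set \<open>U\<close>,
  so that subsets of different objects can be compared as subsets of \<open>U\<close>. The predicate \<open>link\<close>
  describes the morphisms over \<open>U\<close>, and \<open>carried\<close> says that \<open>A \<subseteq> U\<close> comes from a feature of \<open>X\<close>.\<close>

definition embeds :: "'a set \<Rightarrow> 'o \<Rightarrow> ('a \<Rightarrow> 'a) \<Rightarrow> bool" where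
  "embeds U X k \<longleftrightarrow> X \<in> Obj C \<and> inj_on k (fib X) \<and> k ` fib X \<subseteq> U"

definition link :: "'o \<Rightarrow> ('a \<Rightarrow> 'a) \<Rightarrow> 'm \<Rightarrow> 'o \<Rightarrow> ('a \<Rightarrow> 'a) \<Rightarrow> bool" where
  "link X k f Y k' \<longleftrightarrow> f \<in> hom_set C X Y \<and> (\<forall>x\<in>fib X. k' (act f x) = k x)"

definition carried :: "('a set \<times> 'o) set \<Rightarrow> 'o \<Rightarrow> ('a \<Rightarrow> 'a) \<Rightarrow> 'a set \<Rightarrow> bool" where
  "carried \<F> X k A \<longleftrightarrow> (\<exists>B \<subseteq> fib X. k ` B = A \<and> (B, X) \<in> \<F>)"

lemma linkD: "link X k f Y k' \<Longrightarrow> f \<in> hom_set C X Y"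
  "link X k f Y k' \<Longrightarrow> x \<in> fib X \<Longrightarrow> k' (act f x) = k x"
  by (auto simp: link_def)

lemma link_Ident: "X \<in> Obj C \<Longrightarrow> link X k (Ident C X) X k"
  by (simp add: link_def Ident_in_hom_set act_Ident)

lemma link_Cmp:
  assumes "link X k f Y k'" "link Y k' g Z k''"
  shows "link X k (Cmp C g f) Z k''"
proof -
  note h = linkD(1)[OF assms(1)] linkD(1)[OF assms(2)]
  have "k'' (act (Cmp C g f) x) = k x" if x: "x \<in> fib X" for x
    using act_Cmp[OF h x] act_in_fib[OF h(1) x] linkD(2)[OF assms(1) x] linkD(2)[OF assms(2)] by simp
  then show ?thesis using Cmp_in_hom_set[OF h] by (simp add: link_def)
qed

lemma link_image:
  assumes "link X k f Y k'" "B \<subseteq> fib X"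
  shows "act f ` B \<subseteq> fib Y" "k' ` act f ` B = k ` B"
proof -
  show "act f ` B \<subseteq> fib Y" using assms act_in_fib[OF linkD(1)] by blast
  have "k' ` act f ` B = (\<lambda>x. k' (act f x)) ` B" by (rule image_image)
  also have "\<dots> = k ` B" using linkD(2)[OF assms(1)] assms(2) by (intro image_cong) auto
  finally show "k' ` act f ` B = k ` B" .
qed

text \<open>Because \<open>k'\<close> is injective, the direct image of \<open>B\<close> is the only subset of \<open>Y\<close> that can represent
  \<open>k ` B\<close>.\<close>

lemma push_in_feature_iff_carried:
  assumes l: "link X k f Y k'" and e: "embeds U Y k'" and B: "B \<subseteq> fib X"
  shows "push C \<Phi> f (B, X) \<in> \<F> \<longleftrightarrow> carried \<F> Y k' (k ` B)"
proof -
  have "D = act f ` B" if "D \<subseteq> fib Y" "k' ` D = k ` B" for D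
  proof -
    have "k' ` D = k' ` act f ` B" using that link_image[OF l B] by simp
    then show ?thesis
      using inj_on_image_eq_iff[of k' "fib Y" D "act f ` B"] e that(1) link_image(1)[OF l B]
      by (simp add: embeds_def)
  qed
  then have "carried \<F> Y k' (k ` B) \<longleftrightarrow> (act f ` B, Y) \<in> \<F>"
    using link_image[OF l B] unfolding carried_def by blast
  then show ?thesis by (simp add: push_eq[OF linkD(1)[OF l]])
qed

lemma carried_subset: "embeds U X k \<Longrightarrow> carried \<F> X k A \<Longrightarrow> A \<subseteq> U"
  unfolding embeds_def carried_def by blast

lemma carried_pullback_isomorphism:
  assumes \<F>: "feature C \<Phi> \<F>" and l: "link X k f Y k'" and iso: "isomorphism C f"
    and A: "carried \<F> Y k' A"
  shows "carried \<F> X k A"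
proof -
  obtain D where D: "D \<subseteq> fib Y" "k' ` D = A" "(D, Y) \<in> \<F>" using A by (auto simp: carried_def)
  note f = linkD(1)[OF l]
  obtain B where B: "B \<subseteq> fib X" "act f ` B = D"
    using D(1) isomorphism_act_surj[OF iso f] by (metis subset_imageE)
  have "(B, X) \<in> \<F>"
    using \<F> D(3) f iso B hom_set_Obj[OF f] push_eq[OF f, of B] unfolding feature_def by auto
  moreover have "k ` B = A" using link_image(2)[OF l B(1)] B(2) D(2) by simp
  ultimately show ?thesis using B(1) unfolding carried_def by blast
qed

section \<open>Counting features over a cocone\<close>

lemma transition_in_hom_set:
  assumes "filtration C F" "u \<le> v"
  shows "transition F u v \<in> hom_set C (at_level F u) (at_level F v)"
proof -
  have "\<forall>f\<in>Arr real_cat. onArr F f \<in> hom_set C (onObj F (Dom real_cat f)) (onObj F (Cod real_cat f))"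
    using assms(1) by (simp add: filtration_def is_functor_def)
  from bspec[OF this, of "(u, v)"] show ?thesis using assms(2) by (simp add: real_cat_def)
qed

lemma at_level_Obj:
  assumes "filtration C F"
  shows "at_level F u \<in> Obj C"
  using hom_set_Obj(1)[OF transition_in_hom_set[OF assms order_refl]] .

lemma transition_Cmp:
  assumes "filtration C F" "u \<le> v" "v \<le> w"
  shows "Cmp C (transition F v w) (transition F u v) = transition F u w"
proof -
  have "\<forall>f\<in>Arr real_cat. \<forall>g\<in>Arr real_cat. Cod real_cat f = Dom real_cat g \<longrightarrow>
      onArr F (Cmp real_cat g f) = Cmp C (onArr F g) (onArr F f)"
    using assms(1) by (simp add: filtration_def is_functor_def)
  from bspec[OF bspec[OF this, of "(u, v)"], of "(v, w)"]
  show ?thesis using assms(2,3) by (simp add: real_cat_def)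
qed

text \<open>Every level of the compact interval has a neighbourhood within which transitions are
  isomorphisms, and isomorphisms compose.\<close>

lemma isomorphism_transition_no_critical:
  assumes F: "filtration C F" and "u \<le> v" and nc: "\<And>a. a \<in> {u..v} \<Longrightarrow> \<not> critical_value C F a"
  shows "isomorphism C (transition F u v)"
proof -
  have "u \<le> v \<longrightarrow> u \<le> u \<longrightarrow> isomorphism C (transition F u v)"
    using \<open>u \<le> v\<close>
  proof (induction rule: Bolzano)
    case (trans a b c)
    then show ?case
      using isomorphism_Cmp[OF transition_in_hom_set[OF F] _ transition_in_hom_set[OF F]]
        transition_Cmp[OF F] by (metis order_refl)
  next
    case (local x)
    then obtain I where I: "open I" "x \<in> I"
      "\<And>a b. a \<in> I \<Longrightarrow> b \<in> I \<Longrightarrow> a \<le> b \<Longrightarrow> isomorphism C (transition F a b)"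
      using nc[of x] unfolding critical_value_def by auto
    obtain d where "d > 0" "ball x d \<subseteq> I" using openE[OF I(1,2)] .
    then have d: "d > 0" "\<And>y. \<bar>y - x\<bar> < d \<Longrightarrow> y \<in> I"
      by (auto simp: dist_real_def subset_iff abs_minus_commute)
    show ?case
    proof (intro exI[of _ d] conjI allI impI)
      fix a b assume ab: "a \<le> x \<and> x \<le> b \<and> b - a < d"
      then show "isomorphism C (transition F a b)" by (intro I(3) d(2)) auto
    qed (rule d(1))
  qed
  then show ?thesis using \<open>u \<le> v\<close> by simp
qed

lemma tame_eventually_constant:
  assumes "tame_filtration C F"
  shows "\<exists>N. (\<forall>u v. N \<le> u \<and> u \<le> v \<longrightarrow> isomorphism C (transition F u v)) \<and>
    (\<forall>u v. u \<le> v \<and> v \<le> - N \<longrightarrow> isomorphism C (transition F u v))"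
proof -
  have F: "filtration C F" and fin: "finite {a. critical_value C F a}"
    using assms by (auto simp: tame_filtration_def)
  obtain M where M: "\<And>a. critical_value C F a \<Longrightarrow> \<bar>a\<bar> \<le> M"
    using finite_imp_bounded[OF fin] unfolding bounded_iff by auto
  show ?thesis
  proof (intro exI[of _ "max 0 M + 1"] conjI allI impI)
    fix u v :: real
    show "isomorphism C (transition F u v)" if "max 0 M + 1 \<le> u \<and> u \<le> v"
      using that M by (intro isomorphism_transition_no_critical[OF F]) fastforce+
    show "isomorphism C (transition F u v)" if "u \<le> v \<and> v \<le> - (max 0 M + 1)"
      using that M by (intro isomorphism_transition_no_critical[OF F]) fastforce+
  qed
qed

definition cocone :: "('o, 'm) filtr \<Rightarrow> 'a set \<Rightarrow> (real \<Rightarrow> 'a \<Rightarrow> 'a) \<Rightarrow> bool" where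
  "cocone F U j \<longleftrightarrow> finite U \<and> (\<forall>u. embeds U (at_level F u) (j u)) \<and>
     (\<forall>u v. u \<le> v \<longrightarrow> link (at_level F u) (j u) (transition F u v) (at_level F v) (j v))"

lemma coconeD:
  "cocone F U j \<Longrightarrow> finite U"
  "cocone F U j \<Longrightarrow> embeds U (at_level F u) (j u)"
  "cocone F U j \<Longrightarrow> u \<le> v \<Longrightarrow> link (at_level F u) (j u) (transition F u v) (at_level F v) (j v)"
  by (auto simp: cocone_def)

definition present :: "('a set \<times> 'o) set \<Rightarrow> ('o, 'm) filtr \<Rightarrow> (real \<Rightarrow> 'a \<Rightarrow> 'a) \<Rightarrow> 'a set \<Rightarrow> real set"
  where "present \<F> F j A = {w. carried \<F> (at_level F w) (j w) A}"

text \<open>Above some level \<open>N\<close> all transitions are isomorphisms. The underlying set at \<open>N\<close> serves as \<open>U\<close>: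
  earlier levels map forward to it, and later levels are pulled back along the bijection.\<close>

lemma tame_has_cocone:
  assumes "tame_filtration C F"
  obtains U j where "cocone F U j"
proof -
  have F: "filtration C F" using assms by (simp add: tame_filtration_def)
  obtain N where N: "\<And>u v. N \<le> u \<Longrightarrow> u \<le> v \<Longrightarrow> isomorphism C (transition F u v)"
    using tame_eventually_constant[OF assms] by blast
  define U where "U = fib (at_level F N)"
  define j where "j u = (if u \<le> N then act (transition F u N)
                          else inv_into U (act (transition F N u)))" for u
  note hom = transition_in_hom_set[OF F]
  have surj: "act (transition F N u) ` U = fib (at_level F u)" if "N \<le> u" for u
    unfolding U_def using isomorphism_act_surj[OF N[OF order_refl that] hom[OF that]] .
  have inv: "inv_into U (act (transition F N u)) (act (transition F N u) x) = x"
    if "N \<le> u" "x \<in> U" for u x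
    using act_inj_on[OF hom[OF that(1)]] that(2) unfolding U_def by (rule inv_into_f_f)
  have comp: "act (transition F v w) (act (transition F u v) x) = act (transition F u w) x"
    if "u \<le> v" "v \<le> w" "x \<in> fib (at_level F u)" for u v w x
    using act_Cmp[OF hom[OF that(1)] hom[OF that(2)] that(3)] transition_Cmp[OF F that(1,2)] by simp
  have "embeds U (at_level F u) (j u)" for u
  proof (cases "u \<le> N")
    case True
    then show ?thesis
      using act_inj_on[OF hom[OF True]] act_in_fib[OF hom[OF True]] at_level_Obj[OF F]
      by (auto simp: embeds_def j_def U_def)
  next
    case False
    then have u: "N \<le> u" by simp
    have "inj_on (j u) (fib (at_level F u))"
      using False surj[OF u] by (simp add: j_def inj_on_inv_into)
    moreover have "j u ` fib (at_level F u) \<subseteq> U"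
      unfolding surj[OF u, symmetric] using False inv[OF u] by (auto simp: j_def)
    ultimately show ?thesis using at_level_Obj[OF F] by (simp add: embeds_def)
  qed
  moreover have "j v (act (transition F u v) x) = j u x"
    if "u \<le> v" "x \<in> fib (at_level F u)" for u v x
  proof -
    consider "v \<le> N" | "u \<le> N" "N < v" | "N < u" using that by linarith
    then show ?thesis
    proof cases
      case 1
      then show ?thesis using that comp by (simp add: j_def)
    next
      case 2
      have "act (transition F u v) x = act (transition F N v) (act (transition F u N) x)"
        using comp[of u N v x] 2 that by simp
      moreover have "act (transition F u N) x \<in> U"
        unfolding U_def using act_in_fib[OF hom] 2 that by blast
      ultimately show ?thesis using 2 inv by (simp add: j_def)
    next
      case 3
      then have "x \<in> act (transition F N u) ` U" using surj[of u] that by simp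
      then obtain y where y: "y \<in> U" "x = act (transition F N u) y" by blast
      then have "act (transition F u v) x = act (transition F N v) y"
        using comp[of N u v y] 3 that by (simp add: U_def)
      then show ?thesis using 3 that y inv by (simp add: j_def)
    qed
  qed
  ultimately have "cocone F U j"
    using finite_fib[OF at_level_Obj[OF F]] hom by (auto simp: cocone_def link_def U_def)
  then show thesis by (rule that)
qed

text \<open>Subsets of an embedded object are counted by their images in \<open>U\<close>, provided that the condition
  on the image forces it to come from the object.\<close>

lemma card_subsets_via_embedding:
  assumes "embeds U X k"
    and "\<And>B. B \<subseteq> fib X \<Longrightarrow> P B \<longleftrightarrow> Q (k ` B)"
    and "\<And>A. A \<subseteq> U \<Longrightarrow> Q A \<Longrightarrow> A \<subseteq> k ` fib X"
  shows "card {(B, Y). Y = X \<and> B \<subseteq> fib X \<and> P B} = card {A \<in> Pow U. Q A}"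
proof (rule bij_betw_same_card[of "\<lambda>(B, Y). k ` B"], rule bij_betw_imageI)
  show "inj_on (\<lambda>(B, Y). k ` B) {(B, Y). Y = X \<and> B \<subseteq> fib X \<and> P B}"
  proof (rule inj_onI)
    fix P1 P2
    assume P1: "P1 \<in> {(B, Y). Y = X \<and> B \<subseteq> fib X \<and> P B}"
      and P2: "P2 \<in> {(B, Y). Y = X \<and> B \<subseteq> fib X \<and> P B}"
      and eq: "(\<lambda>(B, Y). k ` B) P1 = (\<lambda>(B, Y). k ` B) P2"
    obtain B D where B: "P1 = (B, X)" "B \<subseteq> fib X" and D: "P2 = (D, X)" "D \<subseteq> fib X"
      using P1 P2 by auto
    then have "k ` B = k ` D" using eq by simp
    then have "B = D"
      using inj_on_image_eq_iff[of k "fib X" B D] assms(1) B(2) D(2) by (simp add: embeds_def)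
    then show "P1 = P2" using B D by simp
  qed
  show "(\<lambda>(B, Y). k ` B) ` {(B, Y). Y = X \<and> B \<subseteq> fib X \<and> P B} = {A \<in> Pow U. Q A}"
  proof (intro equalityI subsetI)
    fix A assume "A \<in> (\<lambda>(B, Y). k ` B) ` {(B, Y). Y = X \<and> B \<subseteq> fib X \<and> P B}"
    then obtain B where "A = k ` B" "B \<subseteq> fib X" "P B" by auto
    then show "A \<in> {A \<in> Pow U. Q A}" using assms(1,2) by (auto simp: embeds_def)
  next
    fix A assume "A \<in> {A \<in> Pow U. Q A}"
    then have A: "A \<subseteq> U" "Q A" by auto
    then obtain B where B: "B \<subseteq> fib X" "A = k ` B" using assms(3) by (metis subset_imageE)
    then have "P B" using A(2) assms(2) by simp
    then show "A \<in> (\<lambda>(B, Y). k ` B) ` {(B, Y). Y = X \<and> B \<subseteq> fib X \<and> P B}"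
      using B by (intro image_eqI[of _ _ "(B, X)"]) auto
  qed
qed

lemma carried_subset_later:
  assumes j: "cocone F U j" and "x \<le> u" and A: "carried \<F> (at_level F x) (j x) A"
  shows "A \<subseteq> j u ` fib (at_level F u)"
proof -
  obtain B where B: "B \<subseteq> fib (at_level F x)" "j x ` B = A" using A by (auto simp: carried_def)
  from link_image[OF coconeD(3)[OF j \<open>x \<le> u\<close>] B(1)] B(2) show ?thesis by blast
qed

lemma steady_generator_eq:
  assumes j: "cocone F U j" and "u \<le> v"
  shows "steady_generator C \<Phi> \<F> F u v = card {A \<in> Pow U. {u..v} \<subseteq> present \<F> F j A}"
proof -
  have "steady_generator C \<Phi> \<F> F u v
      = card {(B, Y). Y = at_level F u \<and> B \<subseteq> fib (at_level F u) \<and>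
          (\<forall>w\<in>{u..v}. push C \<Phi> (transition F u w) (B, at_level F u) \<in> \<F>)}"
    by (simp add: steady_generator_def steady_set_def)
  also have "\<dots> = card {A \<in> Pow U. {u..v} \<subseteq> present \<F> F j A}"
  proof (rule card_subsets_via_embedding[OF coconeD(2)[OF j]])
    fix B assume B: "B \<subseteq> fib (at_level F u)"
    show "(\<forall>w\<in>{u..v}. push C \<Phi> (transition F u w) (B, at_level F u) \<in> \<F>)
        \<longleftrightarrow> {u..v} \<subseteq> present \<F> F j (j u ` B)"
      using push_in_feature_iff_carried[OF coconeD(3)[OF j] coconeD(2)[OF j] B]
      by (auto simp: present_def)
  next
    fix A assume "{u..v} \<subseteq> present \<F> F j A"
    then have "u \<in> present \<F> F j A" using \<open>u \<le> v\<close> by auto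
    then show "A \<subseteq> j u ` fib (at_level F u)"
      using carried_subset_later[OF j order_refl] by (simp add: present_def)
  qed
  finally show ?thesis .
qed

lemma ranging_generator_eq:
  assumes j: "cocone F U j" and "u \<le> v"
  shows "ranging_generator C \<Phi> \<F> F u v =
    card {A \<in> Pow U. (\<exists>x\<in>present \<F> F j A. x \<le> u) \<and> (\<exists>y\<in>present \<F> F j A. v \<le> y)}"
proof -
  have "ranging_generator C \<Phi> \<F> F u v
      = card {(B, Y). Y = at_level F u \<and> B \<subseteq> fib (at_level F u) \<and>
          (\<exists>x\<le>u. \<exists>y\<ge>v. \<exists>A' \<subseteq> fib (at_level F x). (A', at_level F x) \<in> \<F> \<and>
           (B, at_level F u) = push C \<Phi> (transition F x u) (A', at_level F x) \<and>
           push C \<Phi> (transition F u y) (B, at_level F u) \<in> \<F>)}"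
    by (simp add: ranging_generator_def ranging_set_def)
  also have "\<dots> = card {A \<in> Pow U. (\<exists>x\<in>present \<F> F j A. x \<le> u) \<and> (\<exists>y\<in>present \<F> F j A. v \<le> y)}"
  proof (rule card_subsets_via_embedding[OF coconeD(2)[OF j]])
    fix B assume B: "B \<subseteq> fib (at_level F u)"
    have early: "(\<exists>A' \<subseteq> fib (at_level F x). (A', at_level F x) \<in> \<F> \<and>
           (B, at_level F u) = push C \<Phi> (transition F x u) (A', at_level F x))
        \<longleftrightarrow> x \<in> present \<F> F j (j u ` B)" if "x \<le> u" for x
    proof -
      note l = coconeD(3)[OF j that]
      have "(B, at_level F u) = push C \<Phi> (transition F x u) (A', at_level F x)
        \<longleftrightarrow> j x ` A' = j u ` B" if A': "A' \<subseteq> fib (at_level F x)" for A'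
      proof -
        have "j x ` A' = j u ` B \<longleftrightarrow> act (transition F x u) ` A' = B"
          using inj_on_image_eq_iff[of "j u" "fib (at_level F u)" "act (transition F x u) ` A'" B]
            coconeD(2)[OF j, of u] link_image[OF l A'] B by (simp add: embeds_def)
        then show ?thesis by (auto simp: push_eq[OF linkD(1)[OF l]])
      qed
      then show ?thesis unfolding present_def carried_def by blast
    qed
    have late: "push C \<Phi> (transition F u y) (B, at_level F u) \<in> \<F>
        \<longleftrightarrow> y \<in> present \<F> F j (j u ` B)" if "v \<le> y" for y
      using push_in_feature_iff_carried[OF coconeD(3)[OF j] coconeD(2)[OF j] B, of y] that \<open>u \<le> v\<close>
      by (simp add: present_def)
    show "(\<exists>x\<le>u. \<exists>y\<ge>v. \<exists>A' \<subseteq> fib (at_level F x). (A', at_level F x) \<in> \<F> \<and>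
           (B, at_level F u) = push C \<Phi> (transition F x u) (A', at_level F x) \<and>
           push C \<Phi> (transition F u y) (B, at_level F u) \<in> \<F>)
      \<longleftrightarrow> (\<exists>x\<in>present \<F> F j (j u ` B). x \<le> u) \<and> (\<exists>y\<in>present \<F> F j (j u ` B). v \<le> y)"
      (is "?L \<longleftrightarrow> ?R")
    proof -
      define E where "E x \<longleftrightarrow> (\<exists>A' \<subseteq> fib (at_level F x). (A', at_level F x) \<in> \<F> \<and>
           (B, at_level F u) = push C \<Phi> (transition F x u) (A', at_level F x))" for x
      define L where "L y \<longleftrightarrow> push C \<Phi> (transition F u y) (B, at_level F u) \<in> \<F>" for y
      have "?L \<longleftrightarrow> (\<exists>x\<le>u. E x) \<and> (\<exists>y\<ge>v. L y)" unfolding E_def L_def by blast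
      also have "\<dots> \<longleftrightarrow> ?R" using early[folded E_def] late[folded L_def] by blast
      finally show ?thesis .
    qed
  next
    fix A assume "(\<exists>x\<in>present \<F> F j A. x \<le> u) \<and> (\<exists>y\<in>present \<F> F j A. v \<le> y)"
    then show "A \<subseteq> j u ` fib (at_level F u)"
      using carried_subset_later[OF j] unfolding present_def by blast
  qed
  finally show ?thesis .
qed

section \<open>Consequences of balancedness for chains of morphisms\<close>

text \<open>Step filtrations visit the objects of a sequence of morphisms. The second index is the number of
  morphisms composed, which makes composition an induction on it.\<close>

primrec chain_arrow :: "(nat \<Rightarrow> 'o) \<Rightarrow> (nat \<Rightarrow> 'm) \<Rightarrow> nat \<Rightarrow> nat \<Rightarrow> 'm" where
  "chain_arrow X f i 0 = Ident C (X i)"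
| "chain_arrow X f i (Suc n) = Cmp C (f (i + n)) (chain_arrow X f i n)"

definition chain_cocone ::
  "(nat \<Rightarrow> 'o) \<Rightarrow> (nat \<Rightarrow> 'm) \<Rightarrow> 'a set \<Rightarrow> (nat \<Rightarrow> 'a \<Rightarrow> 'a) \<Rightarrow> bool" where
  "chain_cocone X f U k \<longleftrightarrow> finite U \<and> (\<forall>n. embeds U (X n) (k n)) \<and>
     (\<forall>n. link (X n) (k n) (f n) (X (Suc n)) (k (Suc n)))"

lemma chain_arrow_link:
  assumes "chain_cocone X f U k"
  shows "link (X i) (k i) (chain_arrow X f i n) (X (i + n)) (k (i + n))"
proof (induction n)
  case 0
  then show ?case using assms by (simp add: chain_cocone_def embeds_def link_Ident)
next
  case (Suc n)
  have "link (X (i + n)) (k (i + n)) (f (i + n)) (X (Suc (i + n))) (k (Suc (i + n)))"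
    using assms by (simp add: chain_cocone_def)
  from link_Cmp[OF Suc.IH this] show ?case by simp
qed

lemma chain_arrow_Cmp:
  assumes ch: "chain_cocone X f U k"
  shows "Cmp C (chain_arrow X f (i + n) m) (chain_arrow X f i n) = chain_arrow X f i (n + m)"
proof (induction m)
  case 0
  then show ?case using Cmp_Ident(2)[OF linkD(1)[OF chain_arrow_link[OF ch]]] by simp
next
  case (Suc m)
  have "f (i + n + m) \<in> hom_set C (X (i + n + m)) (X (Suc (i + n + m)))"
    using ch linkD(1) unfolding chain_cocone_def by blast
  from Cmp_assoc[OF linkD(1)[OF chain_arrow_link[OF ch, of i n]]
      linkD(1)[OF chain_arrow_link[OF ch, of "i + n" m]] this]
  show ?case using Suc.IH by (simp add: add.assoc)
qed

definition chain_filtration ::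
  "(nat \<Rightarrow> 'o) \<Rightarrow> (nat \<Rightarrow> 'm) \<Rightarrow> (real \<Rightarrow> nat) \<Rightarrow> ('o, 'm) filtr" where
  "chain_filtration X f s =
     \<lparr>onObj = \<lambda>w. X (s w), onArr = \<lambda>(u, v). chain_arrow X f (s u) (s v - s u)\<rparr>"

lemma chain_filtration_simps [simp]:
  "at_level (chain_filtration X f s) w = X (s w)"
  "transition (chain_filtration X f s) u v = chain_arrow X f (s u) (s v - s u)"
  by (simp_all add: chain_filtration_def)

lemma chain_arrow_link_le:
  assumes "chain_cocone X f U k" "a \<le> b"
  shows "link (X a) (k a) (chain_arrow X f a (b - a)) (X b) (k b)"
  using chain_arrow_link[OF assms(1), of a "b - a"] assms(2) by simp

lemma chain_arrow_Cmp_le: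
  assumes "chain_cocone X f U k" "a \<le> b" "b \<le> c"
  shows "Cmp C (chain_arrow X f b (c - b)) (chain_arrow X f a (b - a)) = chain_arrow X f a (c - a)"
  using chain_arrow_Cmp[OF assms(1), of a "b - a" "c - b"] assms(2,3) by simp

lemma chain_filtration_cocone:
  assumes "chain_cocone X f U k" "mono s"
  shows "filtration C (chain_filtration X f s)"
    "cocone (chain_filtration X f s) U (\<lambda>w. k (s w))"
proof -
  have obj: "X n \<in> Obj C" for n using assms(1) by (auto simp: chain_cocone_def embeds_def)
  note le = monoD[OF assms(2)]
  show "filtration C (chain_filtration X f s)"
    unfolding filtration_def is_functor_def
    using obj linkD(1)[OF chain_arrow_link_le[OF assms(1)]] chain_arrow_Cmp_le[OF assms(1)] le
    by (auto simp: real_cat_def)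
  show "cocone (chain_filtration X f s) U (\<lambda>w. k (s w))"
    unfolding cocone_def using assms(1) chain_arrow_link_le[OF assms(1)] le
    by (auto simp: chain_cocone_def)
qed

definition staircase :: "real \<Rightarrow> real \<Rightarrow> real \<Rightarrow> nat \<Rightarrow> nat \<Rightarrow> nat \<Rightarrow> nat \<Rightarrow> real \<Rightarrow> nat" where
  "staircase a b c h i j l w = (if w < a then h else if w < b then i else if w < c then j else l)"

lemma mono_staircase:
  "a \<le> b \<Longrightarrow> b \<le> c \<Longrightarrow> h \<le> i \<Longrightarrow> i \<le> j \<Longrightarrow> j \<le> l \<Longrightarrow> mono (staircase a b c h i j l)"
  by (auto simp: mono_def staircase_def)

lemma tame_chain_filtration:
  assumes ch: "chain_cocone X f U k" and s: "s = staircase a b c h i j l" and "mono s"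
  shows "tame_filtration C (chain_filtration X f s)"
proof -
  have "x \<in> {a, b, c}" if x: "critical_value C (chain_filtration X f s) x" for x
  proof (rule ccontr)
    assume "x \<notin> {a, b, c}"
    then have d: "0 < Min {\<bar>x - a\<bar>, \<bar>x - b\<bar>, \<bar>x - c\<bar>}" (is "0 < ?d") by simp
    have const: "s u = s x" if "u \<in> ball x ?d" for u
      using that by (auto simp: s staircase_def dist_real_def)
    have "open (ball x ?d) \<and> is_interval (ball x ?d) \<and> x \<in> ball x ?d"
      using d is_interval_ball_real by simp
    then obtain u v where uv: "u \<in> ball x ?d" "v \<in> ball x ?d"
      "\<not> isomorphism C (transition (chain_filtration X f s) u v)"
      using x unfolding critical_value_def by blast
    have "X (s x) \<in> Obj C" using ch by (simp add: chain_cocone_def embeds_def)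
    then show False using uv(3) const[OF uv(1)] const[OF uv(2)] by (simp add: isomorphism_Ident)
  qed
  then have "{x. critical_value C (chain_filtration X f s) x} \<subseteq> {a, b, c}" by blast
  then have "finite {x. critical_value C (chain_filtration X f s) x}"
    by (rule finite_subset[of _ "{a, b, c}"]) auto
  then show ?thesis using chain_filtration_cocone(1)[OF ch \<open>mono s\<close>] by (simp add: tame_filtration_def)
qed

text \<open>All diagrams required of an interleaving commute because between two objects of the chain only
  the composite along the chain is used.\<close>

lemma chain_filtrations_interleaved:
  assumes ch: "chain_cocone X f U k" and "mono s" "mono t"
    and st: "\<And>w. s w \<le> t (w + \<epsilon>)" and ts: "\<And>w. t w \<le> s (w + \<epsilon>)"
  shows "interleaved C \<epsilon> (chain_filtration X f s) (chain_filtration X f t)"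
proof -
  define arrow where "arrow a b = chain_arrow X f a (b - a)" for a b
  have hom: "arrow a b \<in> hom_set C (X a) (X b)" if "a \<le> b" for a b
    using linkD(1)[OF chain_arrow_link_le[OF ch that]] by (simp add: arrow_def)
  have cmp: "Cmp C (arrow b c) (arrow a b) = arrow a c" if "a \<le> b" "b \<le> c" for a b c
    using chain_arrow_Cmp_le[OF ch that] by (simp add: arrow_def)
  have st': "s (w - \<epsilon>) \<le> t w" and ts': "t (w - \<epsilon>) \<le> s w" for w
    using st[of "w - \<epsilon>"] ts[of "w - \<epsilon>"] by simp_all
  have s: "s u \<le> s v" and t: "t u \<le> t v" if "u \<le> v" for u v
    using assms(2,3) that by (auto dest: monoD)
  show ?thesis
    unfolding interleaved_def chain_filtration_simps arrow_def[symmetric]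
  proof (rule exI[of _ "\<lambda>w. arrow (s w) (t (w + \<epsilon>))"],
      rule exI[of _ "\<lambda>w. arrow (t w) (s (w + \<epsilon>))"], intro conjI allI impI)
    fix u v w :: real
    show "arrow (s w) (t (w + \<epsilon>)) \<in> hom_set C (X (s w)) (X (t (w + \<epsilon>)))" by (rule hom[OF st])
    show "arrow (t w) (s (w + \<epsilon>)) \<in> hom_set C (X (t w)) (X (s (w + \<epsilon>)))" by (rule hom[OF ts])
    show "Cmp C (arrow (t w) (s (w + \<epsilon>))) (arrow (s (w - \<epsilon>)) (t (w - \<epsilon> + \<epsilon>)))
        = arrow (s (w - \<epsilon>)) (s (w + \<epsilon>))"
      using cmp[OF st' ts] by simp
    show "Cmp C (arrow (s w) (t (w + \<epsilon>))) (arrow (t (w - \<epsilon>)) (s (w - \<epsilon> + \<epsilon>)))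
        = arrow (t (w - \<epsilon>)) (t (w + \<epsilon>))"
      using cmp[OF ts' st] by simp
    assume "u \<le> v"
    then have "u + \<epsilon> \<le> v + \<epsilon>" by simp
    show "Cmp C (arrow (s (u + \<epsilon>)) (s (v + \<epsilon>))) (arrow (t u) (s (u + \<epsilon>)))
        = Cmp C (arrow (t v) (s (v + \<epsilon>))) (arrow (t u) (t v))"
      using cmp[OF ts s[OF \<open>u + \<epsilon> \<le> v + \<epsilon>\<close>]] cmp[OF t[OF \<open>u \<le> v\<close>] ts] by simp
    show "Cmp C (arrow (t (u + \<epsilon>)) (t (v + \<epsilon>))) (arrow (s u) (t (u + \<epsilon>)))
        = Cmp C (arrow (s v) (t (v + \<epsilon>))) (arrow (s u) (s v))"
      using cmp[OF st t[OF \<open>u + \<epsilon> \<le> v + \<epsilon>\<close>]] cmp[OF s[OF \<open>u \<le> v\<close>] st] by simp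
  qed
qed

text \<open>The form of convexity that the ranging generator can detect: the ranging function only sees the
  first and the last occurrence of a subset, so a gap at \<open>X 2\<close> is detected only if there is no
  occurrence before it in a filtration that omits \<open>X 1\<close>. Hence the alternative at \<open>X 0\<close>, and
  symmetrically the one at \<open>X 3\<close>.\<close>

definition bridging :: "('a set \<times> 'o) set \<Rightarrow> bool" where
  "bridging \<F> \<longleftrightarrow> (\<forall>X f U k A. chain_cocone X f U k \<longrightarrow>
     (carried \<F> (X 1) (k 1) A \<and> carried \<F> (X 3) (k 3) A \<longrightarrow>
        carried \<F> (X 0) (k 0) A \<or> carried \<F> (X 2) (k 2) A) \<and>
     (carried \<F> (X 0) (k 0) A \<and> carried \<F> (X 2) (k 2) A \<longrightarrow>
        carried \<F> (X 1) (k 1) A \<or> carried \<F> (X 3) (k 3) A))"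

definition convex_feature :: "('a set \<times> 'o) set \<Rightarrow> bool" where
  "convex_feature \<F> \<longleftrightarrow> (\<forall>X f U k A i j l. chain_cocone X f U k \<longrightarrow> i \<le> j \<longrightarrow> j \<le> l \<longrightarrow>
     carried \<F> (X i) (k i) A \<longrightarrow> carried \<F> (X l) (k l) A \<longrightarrow> carried \<F> (X j) (k j) A)"

lemma convex_imp_bridging: "convex_feature \<F> \<Longrightarrow> bridging \<F>"
proof -
  assume c: "convex_feature \<F>"
  have *: "carried \<F> (X j) (k j) A" if "chain_cocone X f U k" "i \<le> j" "j \<le> l"
    "carried \<F> (X i) (k i) A" "carried \<F> (X l) (k l) A" for X f U k i j l A
    using c that unfolding convex_feature_def by blast
  show ?thesis
    unfolding bridging_def using *[of _ _ _ _ 1 2 3] *[of _ _ _ _ 0 1 2] by simp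
qed

lemma tame_balancedD:
  assumes "tame_balanced C \<pi>" and ch: "chain_cocone X f U k"
    and s: "s = staircase a b c h i j l" "mono s"
    and t: "t = staircase a' b' c' h' i' j' l'" "mono t"
    and st: "\<And>w. s w \<le> t (w + 1)" and ts: "\<And>w. t w \<le> s (w + 1)" and "u \<le> v"
  shows "\<pi> (chain_filtration X f s) (u - 1) (v + 1) \<le> \<pi> (chain_filtration X f t) u v"
proof -
  have "compatible 1 (\<pi> (chain_filtration X f s)) (\<pi> (chain_filtration X f t))"
    using assms(1) tame_chain_filtration[OF ch s] tame_chain_filtration[OF ch t]
      chain_filtrations_interleaved[OF ch s(2) t(2) st ts]
    unfolding tame_balanced_def by (meson zero_le_one)
  then show ?thesis using \<open>u \<le> v\<close> by (simp add: compatible_def)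
qed

text \<open>One filtration jumps directly from \<open>X i\<close> to \<open>X l\<close>, the other one stays at \<open>X j\<close> for a while around
  the jump. Over a range that covers these jumps, the first counts the subsets that are features
  at \<open>X i\<close> and \<open>X l\<close>, the second those that are also features at \<open>X j\<close>, and balancedness forbids the
  second number to be smaller.\<close>

lemma steady_balanced_imp_convex:
  assumes bal: "tame_balanced C (steady_generator C \<Phi> \<F>)"
  shows "convex_feature \<F>"
  unfolding convex_feature_def
proof (intro allI impI)
  fix X f U k A and i j l :: nat
  assume ch: "chain_cocone X f U k" and "i \<le> j" "j \<le> l"
    and A: "carried \<F> (X i) (k i) A" "carried \<F> (X l) (k l) A"
  define S where "S A = {n. carried \<F> (X n) (k n) A}" for A
  define s t where "s = staircase 0 1 2 i i l l" and "t = staircase 0 1 2 i j j l"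
  have m: "mono s" "mono t"
    using \<open>i \<le> j\<close> \<open>j \<le> l\<close> by (auto simp: s_def t_def intro!: mono_staircase)
  have count: "steady_generator C \<Phi> \<F> (chain_filtration X f r) u v
      = card {A \<in> Pow U. \<forall>w\<in>{u..v}. r w \<in> S A}" if "mono r" "u \<le> v" for r u v
  proof -
    have "{u..v} \<subseteq> present \<F> (chain_filtration X f r) (\<lambda>w. k (r w)) A \<longleftrightarrow> (\<forall>w\<in>{u..v}. r w \<in> S A)" for A
      by (auto simp: present_def S_def)
    then show ?thesis
      using steady_generator_eq[OF chain_filtration_cocone(2)[OF ch that(1)] that(2), of \<F>] by simp
  qed
  let ?P = "{A \<in> Pow U. \<forall>w\<in>{-2..3}. s w \<in> S A}" and ?Q = "{A \<in> Pow U. \<forall>w\<in>{-1..2}. t w \<in> S A}"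
  have "s w \<le> t (w + 1)" "t w \<le> s (w + 1)" for w
    using \<open>i \<le> j\<close> \<open>j \<le> l\<close> by (auto simp: s_def t_def staircase_def)
  from tame_balancedD[OF bal ch s_def m(1) t_def m(2) this, of "-1" "2"]
  have "card ?P \<le> card ?Q"
    using count[OF m(1), of "-2" "3"] count[OF m(2), of "-1" "2"] by simp
  moreover have "?Q \<subseteq> ?P"
  proof
    fix B assume B: "B \<in> ?Q"
    then have "t (-1) \<in> S B" "t 2 \<in> S B" by simp_all
    then show "B \<in> ?P" using B by (auto simp: s_def t_def staircase_def)
  qed
  moreover have "finite ?P" using ch by (simp add: chain_cocone_def)
  ultimately have "?Q = ?P" by (intro card_seteq)
  moreover have "A \<subseteq> U" using carried_subset A(1) ch unfolding chain_cocone_def by blast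
  then have "A \<in> ?P" using A by (auto simp: s_def staircase_def S_def)
  ultimately have "A \<in> ?Q" by blast
  then have "t 1 \<in> S A" by simp
  then show "carried \<F> (X j) (k j) A" by (simp add: t_def staircase_def S_def)
qed

text \<open>For the first part, one filtration passes through all four objects and the other one waits at
  \<open>X 0\<close> while the first visits \<open>X 1\<close>. Both have reached \<open>X 2\<close> when counting begins and \<open>X 3\<close> when it
  ends. The first filtration counts what has occurred at \<open>X 0\<close>, \<open>X 1\<close> or \<open>X 2\<close> and occurs at \<open>X 3\<close>; the
  second one does not see \<open>X 1\<close>, but by balancedness counts at least as much. The second part
  mirrors this: counting begins at \<open>X 0\<close> and ends at \<open>X 1\<close>, and the other filtration skips \<open>X 2\<close>.\<close>

lemma ranging_balanced_imp_bridging: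
  assumes bal: "tame_balanced C (ranging_generator C \<Phi> \<F>)"
  shows "bridging \<F>"
  unfolding bridging_def
proof (intro allI impI conjI)
  fix X f U k A
  assume ch: "chain_cocone X f U k"
  define S where "S A = {n. carried \<F> (X n) (k n) A}" for A
  have count: "ranging_generator C \<Phi> \<F> (chain_filtration X f r) u v
      = card {A \<in> Pow U. (\<exists>x\<le>u. r x \<in> S A) \<and> (\<exists>y\<ge>v. r y \<in> S A)}" if "mono r" "u \<le> v" for r u v
  proof -
    have "(\<exists>x\<in>present \<F> (chain_filtration X f r) (\<lambda>w. k (r w)) A. x \<le> u) = (\<exists>x\<le>u. r x \<in> S A)"
      "(\<exists>y\<in>present \<F> (chain_filtration X f r) (\<lambda>w. k (r w)) A. v \<le> y) = (\<exists>y\<ge>v. r y \<in> S A)" for A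
      by (auto simp: present_def S_def)
    then show ?thesis
      using ranging_generator_eq[OF chain_filtration_cocone(2)[OF ch that(1)] that(2), of \<F>] by simp
  qed
  have sub: "A \<subseteq> U" if "carried \<F> (X n) (k n) A" for n
    using carried_subset that ch unfolding chain_cocone_def by blast
  have fin: "finite {A \<in> Pow U. R A}" for R using ch by (simp add: chain_cocone_def)
  show "carried \<F> (X 0) (k 0) A \<or> carried \<F> (X 2) (k 2) A"
    if A: "carried \<F> (X 1) (k 1) A \<and> carried \<F> (X 3) (k 3) A"
  proof -
    (* The visit to X 1 has length 1, the parameter of the interleaving; X 2 is kept long enough
       to contain both levels 1 and 2 at which counting begins. *)
    define s t where "s = staircase 0 1 3 0 1 2 3" and "t = staircase 0 1 3 0 0 2 3"
    have m: "mono s" "mono t" by (auto simp: s_def t_def intro!: mono_staircase)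
    let ?P = "{A \<in> Pow U. (\<exists>x\<le>1. s x \<in> S A) \<and> (\<exists>y\<ge>4. s y \<in> S A)}"
    let ?Q = "{A \<in> Pow U. (\<exists>x\<le>2. t x \<in> S A) \<and> (\<exists>y\<ge>3. t y \<in> S A)}"
    have "s w \<le> t (w + 1)" "t w \<le> s (w + 1)" for w
      by (auto simp: s_def t_def staircase_def)
    from tame_balancedD[OF bal ch s_def m(1) t_def m(2) this, of "2" "3"]
    have "card ?P \<le> card ?Q"
      using count[OF m(1), of "1" "4"] count[OF m(2), of "2" "3"] by simp
    moreover have "?Q \<subseteq> ?P"
    proof
      fix B assume "B \<in> ?Q"
      then obtain x y where B: "B \<in> Pow U" "x \<le> 2" "t x \<in> S B" "3 \<le> y" "t y \<in> S B" by blast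
      define x' :: real where "x' = (if x < 1 then -1 else 1)"
      have "x' \<le> 1" by (simp add: x'_def)
      moreover have "s x' = t x" "s 4 = t y"
        using B(2,4) by (auto simp: s_def t_def staircase_def x'_def)
      ultimately show "B \<in> ?P" using B(1,3,5) by auto
    qed
    ultimately have "?Q = ?P" using fin by (intro card_seteq)
    moreover have "s 0 \<in> S A" "s 4 \<in> S A" using A by (auto simp: s_def staircase_def S_def)
    then have "A \<in> ?P" using sub A by (auto intro: exI[of _ 0] exI[of _ 4])
    ultimately obtain x where "x \<le> 2" "t x \<in> S A" by blast
    then show ?thesis by (auto simp: t_def staircase_def S_def split: if_splits)
  qed
  show "carried \<F> (X 1) (k 1) A \<or> carried \<F> (X 3) (k 3) A"
    if A: "carried \<F> (X 0) (k 0) A \<and> carried \<F> (X 2) (k 2) A"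
  proof -
    (* Now the visit to X 2 has length 1, and X 1 contains both levels 2 and 3 at which counting ends. *)
    define s t where "s = staircase 0 5 6 0 1 2 3" and "t = staircase 0 5 6 0 1 3 3"
    have m: "mono s" "mono t" by (auto simp: s_def t_def intro!: mono_staircase)
    let ?P = "{A \<in> Pow U. (\<exists>x\<le>-2. s x \<in> S A) \<and> (\<exists>y\<ge>3. s y \<in> S A)}"
    let ?Q = "{A \<in> Pow U. (\<exists>x\<le>-1. t x \<in> S A) \<and> (\<exists>y\<ge>2. t y \<in> S A)}"
    have "s w \<le> t (w + 1)" "t w \<le> s (w + 1)" for w
      by (auto simp: s_def t_def staircase_def)
    from tame_balancedD[OF bal ch s_def m(1) t_def m(2) this, of "-1" "2"]
    have "card ?P \<le> card ?Q"
      using count[OF m(1), of "-2" "3"] count[OF m(2), of "-1" "2"] by simp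
    moreover have "?Q \<subseteq> ?P"
    proof
      fix B assume "B \<in> ?Q"
      then obtain x y where B: "B \<in> Pow U" "x \<le> -1" "t x \<in> S B" "2 \<le> y" "t y \<in> S B" by blast
      define y' :: real where "y' = (if y < 5 then 3 else 6)"
      have "3 \<le> y'" by (simp add: y'_def)
      moreover have "s (-2) = t x" "s y' = t y"
        using B(2,4) by (auto simp: s_def t_def staircase_def y'_def)
      ultimately show "B \<in> ?P" using B(1,3,5) by auto
    qed
    ultimately have "?Q = ?P" using fin by (intro card_seteq)
    moreover have "s (-2) \<in> S A" "s 5 \<in> S A" using A by (auto simp: s_def staircase_def S_def)
    then have "A \<in> ?P" using sub A by (auto intro: exI[of _ "-2"] exI[of _ 5])
    ultimately obtain y where "y \<ge> 2" "t y \<in> S A" by blast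
    then show ?thesis by (auto simp: t_def staircase_def S_def split: if_splits)
  qed
qed

section \<open>Interleaved filtrations have mutually eroding bars\<close>

lemma four_objects_chain:
  assumes "finite U"
    and "embeds U X0 k0" "embeds U X1 k1" "embeds U X2 k2" "embeds U X3 k3"
    and "link X0 k0 f0 X1 k1" "link X1 k1 f1 X2 k2" "link X2 k2 f2 X3 k3"
  obtains X f k where "chain_cocone X f U k"
    "X 0 = X0" "X 1 = X1" "X 2 = X2" "X 3 = X3" "k 0 = k0" "k 1 = k1" "k 2 = k2" "k 3 = k3"
proof -
  define X where "X n = (if n = 0 then X0 else if n = 1 then X1 else if n = 2 then X2 else X3)" for n :: nat
  define k where "k n = (if n = 0 then k0 else if n = 1 then k1 else if n = 2 then k2 else k3)" for n :: nat
  define f where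
    "f n = (if n = 0 then f0 else if n = 1 then f1 else if n = 2 then f2 else Ident C X3)" for n :: nat
  have "link X3 k3 (Ident C X3) X3 k3" using assms(5) by (simp add: link_Ident embeds_def)
  then have "link (X n) (k n) (f n) (X (Suc n)) (k (Suc n))" for n
    using assms(6-8) by (simp add: X_def k_def f_def numeral_2_eq_2)
  moreover have "embeds U (X n) (k n)" for n using assms(2-5) by (simp add: X_def k_def)
  ultimately have "chain_cocone X f U k" using assms(1) by (simp add: chain_cocone_def)
  then show thesis by (rule that) (simp_all add: X_def k_def)
qed

lemma bridgingD:
  assumes "bridging \<F>" "finite U"
    and "embeds U X0 k0" "embeds U X1 k1" "embeds U X2 k2" "embeds U X3 k3"
    and "link X0 k0 f0 X1 k1" "link X1 k1 f1 X2 k2" "link X2 k2 f2 X3 k3"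
  shows "carried \<F> X1 k1 A \<Longrightarrow> carried \<F> X3 k3 A \<Longrightarrow> carried \<F> X0 k0 A \<or> carried \<F> X2 k2 A"
    and "carried \<F> X0 k0 A \<Longrightarrow> carried \<F> X2 k2 A \<Longrightarrow> carried \<F> X1 k1 A \<or> carried \<F> X3 k3 A"
proof -
  obtain X f k where c: "chain_cocone X f U k"
    and eq: "X 0 = X0" "X 1 = X1" "X 2 = X2" "X 3 = X3" "k 0 = k0" "k 1 = k1" "k 2 = k2" "k 3 = k3"
    by (rule four_objects_chain[OF assms(2-9)])
  have "(carried \<F> (X 1) (k 1) A \<and> carried \<F> (X 3) (k 3) A \<longrightarrow>
        carried \<F> (X 0) (k 0) A \<or> carried \<F> (X 2) (k 2) A) \<and>
     (carried \<F> (X 0) (k 0) A \<and> carried \<F> (X 2) (k 2) A \<longrightarrow>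
        carried \<F> (X 1) (k 1) A \<or> carried \<F> (X 3) (k 3) A)"
    using assms(1) c unfolding bridging_def by blast
  then have *: "(carried \<F> X1 k1 A \<and> carried \<F> X3 k3 A \<longrightarrow> carried \<F> X0 k0 A \<or> carried \<F> X2 k2 A) \<and>
     (carried \<F> X0 k0 A \<and> carried \<F> X2 k2 A \<longrightarrow> carried \<F> X1 k1 A \<or> carried \<F> X3 k3 A)"
    unfolding eq .
  show "carried \<F> X1 k1 A \<Longrightarrow> carried \<F> X3 k3 A \<Longrightarrow> carried \<F> X0 k0 A \<or> carried \<F> X2 k2 A"
    and "carried \<F> X0 k0 A \<Longrightarrow> carried \<F> X2 k2 A \<Longrightarrow> carried \<F> X1 k1 A \<or> carried \<F> X3 k3 A"
    using * by blast+
qed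

lemma convex_featureD:
  assumes "convex_feature \<F>" "finite U"
    and e: "embeds U X0 k0" "embeds U X1 k1" "embeds U X2 k2"
    and l: "link X0 k0 f0 X1 k1" "link X1 k1 f1 X2 k2"
    and A: "carried \<F> X0 k0 A" "carried \<F> X2 k2 A"
  shows "carried \<F> X1 k1 A"
proof -
  have "link X2 k2 (Ident C X2) X2 k2" using e(3) by (simp add: link_Ident embeds_def)
  from four_objects_chain[OF assms(2) e e(3) l this]
  obtain X f k where c: "chain_cocone X f U k"
    and eq: "X 0 = X0" "X 1 = X1" "X 2 = X2" "k 0 = k0" "k 1 = k1" "k 2 = k2" by metis
  have "carried \<F> (X 0) (k 0) A \<longrightarrow> carried \<F> (X 2) (k 2) A \<longrightarrow> carried \<F> (X 1) (k 1) A"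
    using assms(1) c zero_le_one one_le_numeral unfolding convex_feature_def by blast
  then show ?thesis using A unfolding eq by blast
qed

text \<open>Let \<open>A\<close> be present in \<open>F\<close> at \<open>x\<close> and \<open>y\<close>. The chain \<open>F\<^sub>l \<rightarrow> F\<^sub>x \<rightarrow> G\<^bsub>x+\<epsilon>\<^esub> \<rightarrow> F\<^sub>y\<close> shows that \<open>A\<close> is present in \<open>G\<close> at
  \<open>x + \<epsilon>\<close> or in \<open>F\<close> at \<open>l\<close>. For \<open>l\<close> small the composite \<open>F\<^bsub>l-2\<epsilon>\<^esub> \<rightarrow> G\<^bsub>l-\<epsilon>\<^esub> \<rightarrow> F\<^sub>l\<close> is an isomorphism, hence so is
  its second factor, and presence in \<open>F\<close> at \<open>l\<close> gives presence in \<open>G\<close> at \<open>l - \<epsilon>\<close>. The later end is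
  treated with the chain \<open>F\<^sub>x \<rightarrow> G\<^bsub>y-\<epsilon>\<^esub> \<rightarrow> F\<^sub>y \<rightarrow> F\<^sub>r\<close> for large \<open>r\<close>.\<close>

lemma present_eroded:
  assumes br: "bridging \<F>" and feat: "feature C \<Phi> \<F>" and "0 \<le> \<epsilon>"
    and F: "tame_filtration C F" and j: "cocone F U j" and j': "cocone G U j'"
    and \<phi>: "\<And>w. link (at_level F w) (j w) (\<phi> w) (at_level G (w + \<epsilon>)) (j' (w + \<epsilon>))"
    and \<psi>: "\<And>w. link (at_level G w) (j' w) (\<psi> w) (at_level F (w + \<epsilon>)) (j (w + \<epsilon>))"
    and \<psi>\<phi>: "\<And>w. Cmp C (\<psi> w) (\<phi> (w - \<epsilon>)) = transition F (w - \<epsilon>) (w + \<epsilon>)"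
  shows "eroded_in \<epsilon> (present \<F> F j A) (present \<F> G j' A)"
proof -
  have F': "filtration C F" using F by (simp add: tame_filtration_def)
  have fin: "finite U" by (rule coconeD(1)[OF j])
  note e = coconeD(2)[OF j] and e' = coconeD(2)[OF j'] and tr = coconeD(3)[OF j]
  have inG: "w \<in> present \<F> G j' A" if "isomorphism C (transition F (w - \<epsilon>) (w + \<epsilon>))"
    "carried \<F> (at_level F (w + \<epsilon>)) (j (w + \<epsilon>)) A" for w
  proof -
    have "\<phi> (w - \<epsilon>) \<in> hom_set C (at_level F (w - \<epsilon>)) (at_level G w)"
      using linkD(1)[OF \<phi>[of "w - \<epsilon>"]] by simp
    from isomorphism_of_split_epi[OF this linkD(1)[OF \<psi>[of w]]]
    have "isomorphism C (\<psi> w)" using that(1) \<psi>\<phi> by simp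
    from carried_pullback_isomorphism[OF feat \<psi> this that(2)]
    show ?thesis by (simp add: present_def)
  qed
  obtain N where N: "\<And>u v. N \<le> u \<Longrightarrow> u \<le> v \<Longrightarrow> isomorphism C (transition F u v)"
    "\<And>u v. u \<le> v \<Longrightarrow> v \<le> - N \<Longrightarrow> isomorphism C (transition F u v)"
    using tame_eventually_constant[OF F] by blast
  show ?thesis
    unfolding eroded_in_def
  proof (intro ballI impI conjI)
    fix x y assume xy: "x \<in> present \<F> F j A" "y \<in> present \<F> F j A" "x + 2 * \<epsilon> \<le> y"
    have Ax: "carried \<F> (at_level F x) (j x) A" and Ay: "carried \<F> (at_level F y) (j y) A"
      using xy by (auto simp: present_def)
    show "\<exists>x'\<in>present \<F> G j' A. x' \<le> x + \<epsilon>"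
    proof -
      define l where "l = min x (- N)"
      have "l \<le> x" "x + \<epsilon> + \<epsilon> \<le> y" using xy(3) by (auto simp: l_def)
      note last = link_Cmp[OF \<psi>[of "x + \<epsilon>"] tr[OF \<open>x + \<epsilon> + \<epsilon> \<le> y\<close>]]
      from bridgingD(1)[OF br fin e e e' e tr[OF \<open>l \<le> x\<close>] \<phi> last Ax Ay]
      consider "carried \<F> (at_level F l) (j l) A" | "carried \<F> (at_level G (x + \<epsilon>)) (j' (x + \<epsilon>)) A"
        by blast
      then show ?thesis
      proof cases
        case 1
        have "isomorphism C (transition F (l - \<epsilon> - \<epsilon>) (l - \<epsilon> + \<epsilon>))"
          using \<open>0 \<le> \<epsilon>\<close> by (intro N(2)) (auto simp: l_def)
        then have "l - \<epsilon> \<in> present \<F> G j' A" using 1 by (intro inG) simp_all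
        moreover have "l - \<epsilon> \<le> x + \<epsilon>" using \<open>l \<le> x\<close> \<open>0 \<le> \<epsilon>\<close> by linarith
        ultimately show ?thesis by blast
      next
        case 2
        then have "x + \<epsilon> \<in> present \<F> G j' A" by (simp add: present_def)
        then show ?thesis by blast
      qed
    qed
    show "\<exists>y'\<in>present \<F> G j' A. y - \<epsilon> \<le> y'"
    proof -
      define r where "r = max y (N + 2 * \<epsilon>)"
      have "y \<le> r" "x \<le> y - \<epsilon> - \<epsilon>" using xy(3) by (auto simp: r_def)
      have "link (at_level F (y - \<epsilon> - \<epsilon>)) (j (y - \<epsilon> - \<epsilon>)) (\<phi> (y - \<epsilon> - \<epsilon>)) (at_level G (y - \<epsilon>)) (j' (y - \<epsilon>))"
        using \<phi>[of "y - \<epsilon> - \<epsilon>"] by simp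
      note first = link_Cmp[OF tr[OF \<open>x \<le> y - \<epsilon> - \<epsilon>\<close>] this]
      have "link (at_level G (y - \<epsilon>)) (j' (y - \<epsilon>)) (\<psi> (y - \<epsilon>)) (at_level F y) (j y)"
        using \<psi>[of "y - \<epsilon>"] by simp
      from bridgingD(2)[OF br fin e e' e e first this tr[OF \<open>y \<le> r\<close>] Ax Ay]
      consider "carried \<F> (at_level F r) (j r) A" | "carried \<F> (at_level G (y - \<epsilon>)) (j' (y - \<epsilon>)) A"
        by blast
      then show ?thesis
      proof cases
        case 1
        have "isomorphism C (transition F (r - \<epsilon> - \<epsilon>) (r - \<epsilon> + \<epsilon>))"
          using \<open>0 \<le> \<epsilon>\<close> by (intro N(1)) (auto simp: r_def)
        then have "r - \<epsilon> \<in> present \<F> G j' A" using 1 by (intro inG) simp_all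
        moreover have "y - \<epsilon> \<le> r - \<epsilon>" using \<open>y \<le> r\<close> by simp
        ultimately show ?thesis by blast
      next
        case 2
        then have "y - \<epsilon> \<in> present \<F> G j' A" by (simp add: present_def)
        then show ?thesis by blast
      qed
    qed
  qed
qed

text \<open>Composing the embeddings of \<open>F\<close> with the morphisms \<open>\<psi>\<close> embeds \<open>G\<close> into the same set. The
  interleaving identities make both \<open>\<phi>\<close> and \<open>\<psi>\<close> morphisms over \<open>U\<close>, so afterwards \<open>F\<close> and \<open>G\<close> play
  symmetric roles.\<close>

lemma interleaved_cocones:
  assumes F: "filtration C F" and G: "filtration C G" and j: "cocone F U j"
    and "0 \<le> \<epsilon>" and int: "interleaved C \<epsilon> F G"
  obtains \<phi> \<psi> j' where "cocone G U j'"
    "\<And>w. link (at_level F w) (j w) (\<phi> w) (at_level G (w + \<epsilon>)) (j' (w + \<epsilon>))"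
    "\<And>w. link (at_level G w) (j' w) (\<psi> w) (at_level F (w + \<epsilon>)) (j (w + \<epsilon>))"
    "\<And>w. Cmp C (\<psi> w) (\<phi> (w - \<epsilon>)) = transition F (w - \<epsilon>) (w + \<epsilon>)"
    "\<And>w. Cmp C (\<phi> w) (\<psi> (w - \<epsilon>)) = transition G (w - \<epsilon>) (w + \<epsilon>)"
proof -
  obtain \<phi> \<psi> where
    \<phi>: "\<And>w. \<phi> w \<in> hom_set C (at_level F w) (at_level G (w + \<epsilon>))" and
    \<psi>: "\<And>w. \<psi> w \<in> hom_set C (at_level G w) (at_level F (w + \<epsilon>))" and
    \<psi>\<phi>: "\<And>w. Cmp C (\<psi> w) (\<phi> (w - \<epsilon>)) = transition F (w - \<epsilon>) (w + \<epsilon>)" and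
    \<phi>\<psi>: "\<And>w. Cmp C (\<phi> w) (\<psi> (w - \<epsilon>)) = transition G (w - \<epsilon>) (w + \<epsilon>)" and
    nat: "\<And>u v. u \<le> v \<Longrightarrow> Cmp C (transition F (u + \<epsilon>) (v + \<epsilon>)) (\<psi> u) = Cmp C (\<psi> v) (transition G u v)"
    using int unfolding interleaved_def by blast
  define j' where "j' w x = j (w + \<epsilon>) (act (\<psi> w) x)" for w x
  have "embeds U (at_level G w) (j' w)" for w
  proof -
    have e: "inj_on (j (w + \<epsilon>)) (fib (at_level F (w + \<epsilon>)))" "j (w + \<epsilon>) ` fib (at_level F (w + \<epsilon>)) \<subseteq> U"
      using coconeD(2)[OF j, of "w + \<epsilon>"] by (auto simp: embeds_def)
    have sub: "act (\<psi> w) ` fib (at_level G w) \<subseteq> fib (at_level F (w + \<epsilon>))"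
      using act_in_fib[OF \<psi>] by blast
    have "j' w = j (w + \<epsilon>) \<circ> act (\<psi> w)" by (auto simp: j'_def)
    then have "inj_on (j' w) (fib (at_level G w))"
      using comp_inj_on[OF act_inj_on[OF \<psi>] inj_on_subset[OF e(1) sub]] by simp
    moreover have "j' w ` fib (at_level G w) \<subseteq> U" using sub e(2) by (auto simp: j'_def)
    ultimately show ?thesis using at_level_Obj[OF G] by (simp add: embeds_def)
  qed
  moreover have "link (at_level G u) (j' u) (transition G u v) (at_level G v) (j' v)" if "u \<le> v" for u v
  proof -
    have "j' v (act (transition G u v) x) = j' u x" if x: "x \<in> fib (at_level G u)" for x
    proof -
      have uv: "u + \<epsilon> \<le> v + \<epsilon>" using \<open>u \<le> v\<close> by simp
      have "act (\<psi> v) (act (transition G u v) x) = act (Cmp C (\<psi> v) (transition G u v)) x"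
        using act_Cmp[OF transition_in_hom_set[OF G \<open>u \<le> v\<close>] \<psi> x] by simp
      also have "\<dots> = act (transition F (u + \<epsilon>) (v + \<epsilon>)) (act (\<psi> u) x)"
        using act_Cmp[OF \<psi> transition_in_hom_set[OF F uv] x] nat[OF \<open>u \<le> v\<close>] by simp
      finally show ?thesis
        using linkD(2)[OF coconeD(3)[OF j uv] act_in_fib[OF \<psi> x]] by (simp add: j'_def)
    qed
    then show ?thesis using transition_in_hom_set[OF G \<open>u \<le> v\<close>] by (simp add: link_def)
  qed
  ultimately have "cocone G U j'" using coconeD(1)[OF j] by (simp add: cocone_def)
  moreover have "link (at_level F w) (j w) (\<phi> w) (at_level G (w + \<epsilon>)) (j' (w + \<epsilon>))" for w
  proof -
    have "j' (w + \<epsilon>) (act (\<phi> w) x) = j w x" if x: "x \<in> fib (at_level F w)" for x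
    proof -
      have w: "w \<le> w + \<epsilon> + \<epsilon>" using \<open>0 \<le> \<epsilon>\<close> by simp
      have "act (\<psi> (w + \<epsilon>)) (act (\<phi> w) x) = act (transition F w (w + \<epsilon> + \<epsilon>)) x"
        using act_Cmp[OF \<phi> \<psi> x] \<psi>\<phi>[of "w + \<epsilon>"] by simp
      then show ?thesis using linkD(2)[OF coconeD(3)[OF j w] x] by (simp add: j'_def)
    qed
    then show ?thesis using \<phi> by (simp add: link_def)
  qed
  moreover have "link (at_level G w) (j' w) (\<psi> w) (at_level F (w + \<epsilon>)) (j (w + \<epsilon>))" for w
    using \<psi> by (simp add: link_def j'_def)
  ultimately show thesis using \<psi>\<phi> \<phi>\<psi> by (rule that)
qed

lemma bridging_imp_tame_stable:
  assumes br: "bridging \<F>" and feat: "feature C \<Phi> \<F>"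
    and bars: "\<And>F U j. filtration C F \<Longrightarrow> cocone F U j \<Longrightarrow> barcode (Pow U) (present \<F> F j) (\<pi> F)"
  shows "tame_stable C \<pi>"
  unfolding tame_stable_def interleaving_distance_def
proof (intro allI impI Inf_greatest)
  fix F G d
  assume FG: "tame_filtration C F \<and> tame_filtration C G"
    and "d \<in> {ereal \<epsilon> |\<epsilon>. 0 \<le> \<epsilon> \<and> interleaved C \<epsilon> F G}"
  then obtain \<epsilon> where d: "d = ereal \<epsilon>" and \<epsilon>: "0 \<le> \<epsilon>" "interleaved C \<epsilon> F G" by blast
  have tF: "tame_filtration C F" and tG: "tame_filtration C G"
    and F: "filtration C F" and G: "filtration C G"
    using FG by (auto simp: tame_filtration_def)
  obtain U j where j: "cocone F U j" by (rule tame_has_cocone[OF tF])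
  obtain \<phi> \<psi> j' where j': "cocone G U j'"
    and \<phi>: "\<And>w. link (at_level F w) (j w) (\<phi> w) (at_level G (w + \<epsilon>)) (j' (w + \<epsilon>))"
    and \<psi>: "\<And>w. link (at_level G w) (j' w) (\<psi> w) (at_level F (w + \<epsilon>)) (j (w + \<epsilon>))"
    and \<psi>\<phi>: "\<And>w. Cmp C (\<psi> w) (\<phi> (w - \<epsilon>)) = transition F (w - \<epsilon>) (w + \<epsilon>)"
    and \<phi>\<psi>: "\<And>w. Cmp C (\<phi> w) (\<psi> (w - \<epsilon>)) = transition G (w - \<epsilon>) (w + \<epsilon>)"
    by (rule interleaved_cocones[OF F G j \<epsilon>]) (rule that)
  show "bottleneck (\<pi> F) (\<pi> G) \<le> d"
    unfolding d
    by (rule bottleneck_le_of_eroded_bars[OF bars[OF F j] bars[OF G j'] \<epsilon>(1)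
          present_eroded[OF br feat \<epsilon>(1) tF j j' \<phi> \<psi> \<psi>\<phi>]
          present_eroded[OF br feat \<epsilon>(1) tG j' j \<psi> \<phi> \<phi>\<psi>]])
qed

lemma ranging_barcode:
  assumes "filtration C F" and j: "cocone F U j"
  shows "barcode (Pow U) (present \<F> F j) (ranging_generator C \<Phi> \<F> F)"
  using ranging_generator_eq[OF j] coconeD(1)[OF j] by (simp add: barcode_def)

text \<open>By convexity the levels at which a subset is present form an interval, so being present on
  \<open>[u, v]\<close> is the same as being present at some level up to \<open>u\<close> and at some level from \<open>v\<close> on.\<close>

lemma steady_barcode:
  assumes conv: "convex_feature \<F>" and "filtration C F" and j: "cocone F U j"
  shows "barcode (Pow U) (present \<F> F j) (steady_generator C \<Phi> \<F> F)"
proof -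
  have "{u..v} \<subseteq> present \<F> F j A \<longleftrightarrow>
      (\<exists>x\<in>present \<F> F j A. x \<le> u) \<and> (\<exists>y\<in>present \<F> F j A. v \<le> y)" if "u \<le> v" for u v A
  proof
    assume "{u..v} \<subseteq> present \<F> F j A"
    moreover have "u \<in> {u..v}" "v \<in> {u..v}" using that by auto
    ultimately show "(\<exists>x\<in>present \<F> F j A. x \<le> u) \<and> (\<exists>y\<in>present \<F> F j A. v \<le> y)" by blast
  next
    assume "(\<exists>x\<in>present \<F> F j A. x \<le> u) \<and> (\<exists>y\<in>present \<F> F j A. v \<le> y)"
    then obtain x y where x: "carried \<F> (at_level F x) (j x) A" "x \<le> u"
      and y: "carried \<F> (at_level F y) (j y) A" "v \<le> y" by (auto simp: present_def)
    show "{u..v} \<subseteq> present \<F> F j A"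
    proof
      fix w assume "w \<in> {u..v}"
      then have "x \<le> w" "w \<le> y" using x(2) y(2) by auto
      note e = coconeD(2)[OF j]
      from convex_featureD[OF conv coconeD(1)[OF j] e e e
          coconeD(3)[OF j \<open>x \<le> w\<close>] coconeD(3)[OF j \<open>w \<le> y\<close>] x(1) y(1)]
      show "w \<in> present \<F> F j A" by (simp add: present_def)
    qed
  qed
  then show ?thesis
    using steady_generator_eq[OF j] coconeD(1)[OF j] by (simp add: barcode_def)
qed

end

theorem proposition3p6:
  fixes C :: "('o, 'm) cat"
    and \<Phi> :: "('o, 'm, 'a) concretion"
    and \<F> :: "('a set \<times> 'o) set"
  assumes "finitely_concrete_mono_category C \<Phi>"
    and "\<exists>E. empty_like C \<Phi> E"
    and "feature C \<Phi> \<F>"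
    and "triangle_condition C \<Phi>"
  shows "(tame_balanced C (steady_generator C \<Phi> \<F>) \<longrightarrow>
            tame_stable C (steady_generator C \<Phi> \<F>)) \<and>
         (tame_balanced C (ranging_generator C \<Phi> \<F>) \<longrightarrow>
            tame_stable C (ranging_generator C \<Phi> \<F>))"
proof -
  interpret concrete_mono_category C \<Phi> by unfold_locales (rule assms(1))
  show ?thesis
    using bridging_imp_tame_stable[OF ranging_balanced_imp_bridging assms(3) ranging_barcode]
      bridging_imp_tame_stable[OF convex_imp_bridging[OF steady_balanced_imp_convex] assms(3)
        steady_barcode[OF steady_balanced_imp_convex]]
    by blast
qed

end
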